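(* Let $(X,d)$ be a compact metric space, let $f_n:X\to X$, $n\ge0$, be continuous maps such that $\{f_n\}_{n=0}^\infty$ is equi-continuous in $X$, let $A=(a_{ij})_{N\times N}$ be a transition matrix, let $\{V_{i,n}\}_{n=0}^\infty$, $1\le i\le N$, be sequences of nonempty closed subsets of $X$, and let $V_i$, $1\le i\le N$, be disjoint closed subsets of $X$ with $V_{i,n}\subset V_i$ for all $1\le i\le N$, $n\ge0$. For $\alpha=(a_0,a_1,\dots)\in\Sigma_N^+(A)$ put $V_\alpha^{m,n}:=\bigcap_{k=0}^{m}f_n^{-k}(V_{a_k,n+k})$. Assume that: - $V_\alpha^{m,n}\neq\emptyset$ for all $m,n\ge0$ and all $\alpha\in\Sigma_N^+(A)$; - for every $\alpha\in\Sigma_N^+(A)$, the diameter $d(V_\alpha^{m,n})$ converges to $0$ as $m\to\infty$ uniformly with respect to $n\ge0$. Then for every $n\ge0$ there exists a nonempty compact subset $\mathcal C_n\subset\bigcup_{i=1}^N\langle V_{i,n}\rangle$ of $\mathcal K(X)$ with $\bar f_n(\mathcal C_n)=\mathcal C_{n+1}$ such that the invariant subsystem of the induced set-valued system $A_{n+1}=\bar f_n(A_n)$ on $\{\mathcal C_n\}_{n=0}^\infty$ is topologically equi-conjugate to $(\Sigma_N^+(A),\sigma_A)$, and consequently $h(\bar f_{0,\infty},\mathcal C_0)=\log\rho(A)$. Further, if $A$ is irreducible and $\sum_{j=1}^N a_{i_0j}\ge2$ for some $1\le i_0\le N$, then the system $A_{n+1}=\bar f_n(A_n)$ is chaotic in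 the strong sense of Li-Yorke, and is also distributionally chaotic.
   Context: For a sequence of maps $g_n$ of a space $Z$ into itself, $g_i^n:=g_{i+n-1}\circ\cdots\circ g_i$ for $n\ge1$, $g_i^0$ is the identity, and $g_i^{-n}:=(g_i^n)^{-1}$ (preimage). $d(B)$ is the diameter of $B\subset X$. A sequence of maps $h_n:W_n\to Y$ between metric spaces, $W_n$ subsets of a common metric space, is equi-continuous in $\{W_n\}$ if for every $\epsilon>0$ there is $\delta>0$, independent of $n$, such that for all $n\ge0$ points of $W_n$ at distance less than $\delta$ have $h_n$-images at distance less than $\epsilon$; "in $X$" means $W_n=X$ for all $n$. $\mathcal K(X)$ is the set of all nonempty compact subsets of $X$ with the Hausdorff metric $\mathcal H_d(B,C):=\max\{\sup_{b\in B}d(b,C),\sup_{c\in C}d(c,B)\}$ (a compact metric space). For nonempty $K\subset X$, $\langle K\rangle:=\{B\in\mathcal K(X):B\subset K\}$; $\bar f_n:\mathcal K(X)\to\mathcal K(X)$ is $\bar f_n(B):=f_n(B)$; $\bar f_{0,\infty}:=\{\bar f_n\}_{n=0}^\infty$. In $\bar f_n(\mathcal C_n)$ the map $\bar f_n$ is applied elementwise: $\bar f_n(\mathcal C_n)=\{\bar f_n(B):B\in\mathcal C_n\}$. A transition matrix is a matrix $A=(a_{ij})_{N\times N}$, $N\ge2$, with $a_{ij}\in\{0,1\}$, $\sum_{j=1}^N a_{ij}\ge1$ for all $i$ and $\sum_{i=1}^N a_{ij}\ge1$ for all $j$; it is irreducible if for each pair $1\le i,j\le N$ there is $k\ge1$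 such that the $(i,j)$ entry of $A^k$ is positive. $\Sigma_N^+(A):=\{s=(s_0,s_1,\dots):1\le s_j\le N,\ a_{s_js_{j+1}}=1,\ j\ge0\}$, with metric $\hat\rho(\alpha,\beta):=\sum_{i=0}^\infty \hat d(a_i,b_i)/2^i$ for $\alpha=(a_0,a_1,\dots)$, $\beta=(b_0,b_1,\dots)$, where $\hat d(a,b)=0$ if $a=b$ and $1$ otherwise. $\sigma_A:\Sigma_N^+(A)\to\Sigma_N^+(A)$, $\sigma_A((s_0,s_1,s_2,\dots)):=(s_1,s_2,\dots)$. $\rho(A):=\lim_{n\to\infty}\|A^n\|^{1/n}$, where $\|B\|$ denotes the sum of all entries of $B$. For subsets $\mathcal C_n\subset\mathcal K(X)$ with $\bar f_n(\mathcal C_n)\subset\mathcal C_{n+1}$ for all $n\ge0$, the set-valued system restricted to $\{\mathcal C_n\}$ is called its invariant subsystem on $\{\mathcal C_n\}_{n=0}^\infty$. It is topologically equi-conjugate to $(\Sigma_N^+(A),\sigma_A)$ if there are bijections $h_n:\mathcal C_n\to\Sigma_N^+(A)$, $n\ge0$, with $h_{n+1}\circ\bar f_n=\sigma_A\circ h_n$ on $\mathcal C_n$ for all $n\ge0$, such that $\{h_n\}$ is equi-continuous in $\{\mathcal C_n\}$ and $\{h_n^{-1}\}$ is equi-continuous in $\Sigma_N^+(A)$. Topological entropy: for a compact metric space $Z$, maps $g_n:Z\to Z$ and nonempty $Y\subset Z$, $h(g_{0,\infty},Y):=\sup_{\mathcal A}\limsup_{n\to\infty}\frac1n\log\mathcal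 N(\mathcal A_0^n|_Y)$, the supremum over open covers $\mathcal A$ of $Z$, where $\mathcal A_0^n:=\{\bigcap_{j=0}^{n-1}g_0^{-j}(A_j):A_j\in\mathcal A\}$, $\mathcal B|_Y:=\{B\cap Y:B\in\mathcal B\}$, and $\mathcal N(\cdot)$ is the minimal cardinality of a subcover. Chaos: let $(Z,e)$ be a metric space and $g_n:Z\to Z$ maps. The system $z_{n+1}=g_n(z_n)$ is chaotic in the strong sense of Li-Yorke if for some $\delta>0$ there is an uncountable set $S\subset Z$ such that for any distinct $x,y\in S$, $\liminf_{n\to\infty}e(g_0^n(x),g_0^n(y))=0$ and $\limsup_{n\to\infty}e(g_0^n(x),g_0^n(y))>\delta$, and all orbits $\{g_0^n(x)\}_{n\ge0}$, $x\in S$, are bounded. It is distributionally chaotic if there is an uncountable set $D\subset Z$ such that for any distinct $x,y\in D$: (i) $\limsup_{n\to\infty}\frac1n\sum_{i=0}^{n-1}\chi_{[0,\epsilon)}(e(g_0^i(x),g_0^i(y)))=1$ for every $\epsilon>0$, and (ii) $\liminf_{n\to\infty}\frac1n\sum_{i=0}^{n-1}\chi_{[0,\delta)}(e(g_0^i(x),g_0^i(y)))=0$ for some $\delta>0$, where $\chi$ is the characteristic function. *)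

theory Defs
  imports "HOL-Analysis.Analysis"
begin

subsection \<open>Nonautonomous systems\<close>

text \<open>\<open>iterates g i n\<close> is \<open>g\<^sub>i\<^sup>n = g (i + n - 1) \<circ> \<dots> \<circ> g i\<close>.\<close>

primrec iterates :: "(nat \<Rightarrow> 'z \<Rightarrow> 'z) \<Rightarrow> nat \<Rightarrow> nat \<Rightarrow> 'z \<Rightarrow> 'z" where
  "iterates g i 0 = id"
| "iterates g i (Suc n) = g (i + n) \<circ> iterates g i n"

definition equi_continuous ::
  "('w \<Rightarrow> 'w \<Rightarrow> real) \<Rightarrow> (nat \<Rightarrow> 'w set) \<Rightarrow> ('y \<Rightarrow> 'y \<Rightarrow> real) \<Rightarrow> (nat \<Rightarrow> 'w \<Rightarrow> 'y) \<Rightarrow> bool" where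
  "equi_continuous d W e h \<longleftrightarrow>
    (\<forall>\<epsilon>>0. \<exists>\<delta>>0. \<forall>n. \<forall>x\<in>W n. \<forall>y\<in>W n. d x y < \<delta> \<longrightarrow> e (h n x) (h n y) < \<epsilon>)"

text \<open>The invariant subsystem of \<open>g\<close> on \<open>C\<close>, with metric \<open>d\<close>, is equi-conjugate to the
  autonomous system \<open>\<sigma>\<close> on \<open>S\<close>, with metric \<open>e\<close>.\<close>

definition topologically_equi_conjugate ::
  "('z \<Rightarrow> 'z \<Rightarrow> real) \<Rightarrow> (nat \<Rightarrow> 'z set) \<Rightarrow> (nat \<Rightarrow> 'z \<Rightarrow> 'z) \<Rightarrow>
   ('s \<Rightarrow> 's \<Rightarrow> real) \<Rightarrow> 's set \<Rightarrow> ('s \<Rightarrow> 's) \<Rightarrow> bool" where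
  "topologically_equi_conjugate d C g e S \<sigma> \<longleftrightarrow>
    (\<forall>n. g n ` C n \<subseteq> C (Suc n)) \<and>
    (\<exists>h. (\<forall>n. bij_betw (h n) (C n) S) \<and>
         (\<forall>n. \<forall>x\<in>C n. h (Suc n) (g n x) = \<sigma> (h n x)) \<and>
         equi_continuous d C e h \<and>
         equi_continuous e (\<lambda>n. S) d (\<lambda>n. inv_into (C n) (h n)))"

subsection \<open>Topological entropy\<close>

definition open_covers :: "'z topology \<Rightarrow> 'z set set set" where
  "open_covers T = {\<A>. (\<forall>U\<in>\<A>. openin T U) \<and> \<Union>\<A> = topspace T}"

text \<open>The family \<open>\<A>\<^sub>0\<^sup>n\<close>, with preimages taken in the carrier of \<open>T\<close>.\<close>

definition joined_cover ::
  "'z topology \<Rightarrow> (nat \<Rightarrow> 'z \<Rightarrow> 'z) \<Rightarrow> 'z set set \<Rightarrow> nat \<Rightarrow> 'z set set" where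
  "joined_cover T g \<A> n =
    {topspace T \<inter> (\<Inter>j<n. iterates g 0 j -` U j) | U. \<forall>j<n. U j \<in> \<A>}"

text \<open>Minimal cardinality of a subcover of a cover \<open>\<B>\<close> of \<open>Y\<close>. Infinite subfamilies are excluded
  because \<^const>\<open>card\<close> is 0 on them; a finite subcover exists whenever \<open>\<B>\<close> comes
  from an open cover of a compact space, as it does below.\<close>

definition min_subcover_card :: "'z set set \<Rightarrow> 'z set \<Rightarrow> nat" where
  "min_subcover_card \<B> Y = Inf {card \<D> | \<D>. \<D> \<subseteq> \<B> \<and> finite \<D> \<and> \<Union>\<D> = Y}"

text \<open>The entropy \<open>h(g\<^sub>0\<^sub>,\<^sub>\<infinity>, Y)\<close>, for a compact topology \<open>T\<close> and nonempty \<open>Y \<subseteq> topspace T\<close>.\<close>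

definition topological_entropy ::
  "'z topology \<Rightarrow> (nat \<Rightarrow> 'z \<Rightarrow> 'z) \<Rightarrow> 'z set \<Rightarrow> ereal" where
  "topological_entropy T g Y =
    (SUP \<A>\<in>open_covers T. limsup (\<lambda>n.
       ereal (1 / real n * ln (real (min_subcover_card ((\<lambda>B. B \<inter> Y) ` joined_cover T g \<A> n) Y)))))"

subsection \<open>Chaos\<close>

definition strongly_Li_Yorke_chaotic ::
  "'z set \<Rightarrow> ('z \<Rightarrow> 'z \<Rightarrow> real) \<Rightarrow> (nat \<Rightarrow> 'z \<Rightarrow> 'z) \<Rightarrow> bool" where
  "strongly_Li_Yorke_chaotic Z e g \<longleftrightarrow>
    (\<exists>\<delta>>0. \<exists>S\<subseteq>Z. uncountable S \<and>
      (\<forall>x\<in>S. \<forall>y\<in>S. x \<noteq> y \<longrightarrow>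
         liminf (\<lambda>n. ereal (e (iterates g 0 n x) (iterates g 0 n y))) = 0 \<and>
         limsup (\<lambda>n. ereal (e (iterates g 0 n x) (iterates g 0 n y))) > ereal \<delta>) \<and>
      (\<forall>x\<in>S. Metric_space.mbounded Z e (range (\<lambda>n. iterates g 0 n x))))"

definition close_frequency ::
  "('z \<Rightarrow> 'z \<Rightarrow> real) \<Rightarrow> (nat \<Rightarrow> 'z \<Rightarrow> 'z) \<Rightarrow> 'z \<Rightarrow> 'z \<Rightarrow> real \<Rightarrow> nat \<Rightarrow> real" where
  "close_frequency e g x y \<epsilon> n =
    1 / real n * (\<Sum>i<n. indicator {0..<\<epsilon>} (e (iterates g 0 i x) (iterates g 0 i y)))"

definition distributionally_chaotic ::
  "'z set \<Rightarrow> ('z \<Rightarrow> 'z \<Rightarrow> real) \<Rightarrow> (nat \<Rightarrow> 'z \<Rightarrow> 'z) \<Rightarrow> bool" where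
  "distributionally_chaotic Z e g \<longleftrightarrow>
    (\<exists>D\<subseteq>Z. uncountable D \<and>
      (\<forall>x\<in>D. \<forall>y\<in>D. x \<noteq> y \<longrightarrow>
         (\<forall>\<epsilon>>0. limsup (\<lambda>n. ereal (close_frequency e g x y \<epsilon> n)) = 1) \<and>
         (\<exists>\<delta>>0. liminf (\<lambda>n. ereal (close_frequency e g x y \<delta> n)) = 0)))"

subsection \<open>The hyperspace of nonempty compact sets\<close>

definition nonempty_compacts :: "'a::metric_space set set" where
  "nonempty_compacts = {B. compact B \<and> B \<noteq> {}}"

definition compacts_within :: "'a::metric_space set \<Rightarrow> 'a set set" where
  "compacts_within K = {B \<in> nonempty_compacts. B \<subseteq> K}"

text \<open>The value 0 outside \<^const>\<open>nonempty_compacts\<close> is needed for the axioms of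
  \<^locale>\<open>Metric_space\<close>, which demand symmetry and nonnegativity on the whole type.\<close>

definition hausdorff_dist :: "'a::metric_space set \<Rightarrow> 'a set \<Rightarrow> real" where
  "hausdorff_dist B C =
    (if B \<in> nonempty_compacts \<and> C \<in> nonempty_compacts
     then max (SUP b\<in>B. infdist b C) (SUP c\<in>C. infdist c B) else 0)"

lemma bdd_above_infdist_compact:
  fixes B C :: "'a::metric_space set"
  assumes "compact B"
  shows "bdd_above ((\<lambda>b. infdist b C) ` B)"
  by (intro bounded_imp_bdd_above compact_imp_bounded compact_continuous_image
      continuous_on_infdist continuous_on_id assms)

lemma infdist_le_hausdorff_dist:
  assumes "B \<in> nonempty_compacts" "C \<in> nonempty_compacts" "b \<in> B"
  shows "infdist b C \<le> hausdorff_dist B C"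
proof -
  have "infdist b C \<le> (SUP b\<in>B. infdist b C)"
    using assms by (intro cSUP_upper bdd_above_infdist_compact) (auto simp: nonempty_compacts_def)
  then show ?thesis using assms by (simp add: hausdorff_dist_def)
qed

lemma hausdorff_dist_commute: "hausdorff_dist B C = hausdorff_dist C B"
  by (simp add: hausdorff_dist_def max.commute)

lemma Metric_space_hausdorff: "Metric_space nonempty_compacts hausdorff_dist"
proof
  fix B C :: "'a set"
  show "hausdorff_dist B C = hausdorff_dist C B" by (rule hausdorff_dist_commute)
  show "0 \<le> hausdorff_dist B C"
  proof (cases "B \<in> nonempty_compacts \<and> C \<in> nonempty_compacts")
    case True
    then obtain b where "b \<in> B" by (auto simp: nonempty_compacts_def)
    with True show ?thesis
      using infdist_le_hausdorff_dist[of B C b] infdist_nonneg[of b C] by linarith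
  qed (auto simp: hausdorff_dist_def)
next
  fix B C :: "'a set"
  assume BC: "B \<in> nonempty_compacts" "C \<in> nonempty_compacts"
  have sub: "P \<subseteq> Q" if "P \<in> nonempty_compacts" "Q \<in> nonempty_compacts" "hausdorff_dist P Q = 0"
    for P Q :: "'a set"
  proof
    fix p assume "p \<in> P"
    then have "infdist p Q = 0"
      using infdist_le_hausdorff_dist[OF that(1,2)] that(3) infdist_nonneg[of p Q] by force
    then show "p \<in> Q"
      using that(2) in_closed_iff_infdist_zero[of Q p]
      by (auto simp: nonempty_compacts_def compact_imp_closed)
  qed
  show "hausdorff_dist B C = 0 \<longleftrightarrow> B = C"
  proof
    assume "hausdorff_dist B C = 0"
    then show "B = C" using sub BC hausdorff_dist_commute by (metis subset_antisym)
  next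
    assume "B = C"
    then show "hausdorff_dist B C = 0" using BC by (simp add: hausdorff_dist_def nonempty_compacts_def)
  qed
next
  fix B C D :: "'a set"
  assume K: "B \<in> nonempty_compacts" "C \<in> nonempty_compacts" "D \<in> nonempty_compacts"
  have half: "(SUP p\<in>P. infdist p R) \<le> hausdorff_dist P Q + hausdorff_dist Q R"
    if PQR: "P \<in> nonempty_compacts" "Q \<in> nonempty_compacts" "R \<in> nonempty_compacts"
    for P Q R :: "'a set"
  proof (rule cSUP_least)
    show "P \<noteq> {}" using PQR by (simp add: nonempty_compacts_def)
    fix p assume p: "p \<in> P"
    have "infdist p R - hausdorff_dist Q R \<le> (INF q\<in>Q. dist p q)"
    proof (rule cINF_greatest)
      show "Q \<noteq> {}" using PQR by (simp add: nonempty_compacts_def)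
      fix q assume "q \<in> Q"
      then show "infdist p R - hausdorff_dist Q R \<le> dist p q"
        using infdist_triangle[of p R q] infdist_le_hausdorff_dist[OF PQR(2,3)] by fastforce
    qed
    also have "\<dots> = infdist p Q"
      using PQR by (simp add: infdist_notempty nonempty_compacts_def)
    finally show "infdist p R \<le> hausdorff_dist P Q + hausdorff_dist Q R"
      using infdist_le_hausdorff_dist[OF PQR(1,2) p] by linarith
  qed
  show "hausdorff_dist B D \<le> hausdorff_dist B C + hausdorff_dist C D"
    using half[OF K] half[OF K(3,2,1)] K hausdorff_dist_commute[of B C] hausdorff_dist_commute[of C D]
    by (simp add: hausdorff_dist_def[of B D])
qed

abbreviation hausdorff_topology :: "'a::metric_space set topology" where
  "hausdorff_topology \<equiv> Metric_space.mtopology nonempty_compacts hausdorff_dist"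

text \<open>The induced maps \<open>f\<^sub>n\<close> on \<^const>\<open>nonempty_compacts\<close>.\<close>

definition induced :: "(nat \<Rightarrow> 'a \<Rightarrow> 'a) \<Rightarrow> nat \<Rightarrow> 'a set \<Rightarrow> 'a set" where
  "induced f n B = f n ` B"

subsection \<open>Transition matrices and one-sided subshifts\<close>

text \<open>The index set \<open>{1, \<dots>, N}\<close> is a finite type \<open>'n\<close>, with \<open>N = CARD('n)\<close>.\<close>

definition transition_matrix :: "nat ^ 'n ^ 'n \<Rightarrow> bool" where
  "transition_matrix A \<longleftrightarrow>
    CARD('n) \<ge> 2 \<and> (\<forall>i j. A $ i $ j \<in> {0, 1}) \<and>
    (\<forall>i. (\<Sum>j\<in>UNIV. A $ i $ j) \<ge> 1) \<and> (\<forall>j. (\<Sum>i\<in>UNIV. A $ i $ j) \<ge> 1)"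

text \<open>The operation \<open>^\<close> on type \<open>vec\<close> is componentwise, hence a separate matrix power.\<close>

primrec matrix_pow :: "nat ^ 'n ^ 'n \<Rightarrow> nat \<Rightarrow> nat ^ 'n ^ 'n" where
  "matrix_pow A 0 = mat 1"
| "matrix_pow A (Suc k) = matrix_pow A k ** A"

definition irreducible_matrix :: "nat ^ 'n ^ 'n \<Rightarrow> bool" where
  "irreducible_matrix A \<longleftrightarrow> (\<forall>i j. \<exists>k\<ge>1. matrix_pow A k $ i $ j > 0)"

definition entry_sum :: "nat ^ 'n ^ 'n \<Rightarrow> nat" where
  "entry_sum B = (\<Sum>i\<in>UNIV. \<Sum>j\<in>UNIV. B $ i $ j)"

definition matrix_rho :: "nat ^ 'n ^ 'n \<Rightarrow> real" where
  "matrix_rho A = lim (\<lambda>n. root n (real (entry_sum (matrix_pow A n))))"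

definition subshift :: "nat ^ 'n ^ 'n \<Rightarrow> (nat \<Rightarrow> 'n) set" where
  "subshift A = {s. \<forall>j. A $ s j $ s (Suc j) = 1}"

definition symbol_dist :: "(nat \<Rightarrow> 'n) \<Rightarrow> (nat \<Rightarrow> 'n) \<Rightarrow> real" where
  "symbol_dist \<alpha> \<beta> = (\<Sum>i. (if \<alpha> i = \<beta> i then 0 else 1) / 2 ^ i)"

definition shift :: "(nat \<Rightarrow> 'n) \<Rightarrow> nat \<Rightarrow> 'n" where
  "shift s = (\<lambda>j. s (Suc j))"

subsection \<open>Itinerary sets\<close>

text \<open>\<open>itinerary_set f V \<alpha> m n\<close> is \<open>V\<^sub>\<alpha>\<^sup>m\<^sup>,\<^sup>n\<close>, where \<open>V i n\<close> is \<open>V\<^sub>i\<^sub>,\<^sub>n\<close>.\<close>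

definition itinerary_set ::
  "(nat \<Rightarrow> 'a \<Rightarrow> 'a) \<Rightarrow> ('n \<Rightarrow> nat \<Rightarrow> 'a set) \<Rightarrow> (nat \<Rightarrow> 'n) \<Rightarrow> nat \<Rightarrow> nat \<Rightarrow> 'a set" where
  "itinerary_set f V \<alpha> m n = (\<Inter>k\<le>m. iterates f n k -` V (\<alpha> k) (n + k))"

end

theory Submission
  imports Defs
begin

text \<open>
  The family \<open>\<C> n\<close> consists of singletons: for admissible \<open>\<alpha>\<close> the compact sets
  \<open>V\<^sub>\<alpha>\<^sup>m\<^sup>,\<^sup>n\<close> shrink to one point, and \<open>f n\<close> sends the point of \<open>\<alpha>\<close> at time \<open>n\<close> to the
  point of \<open>shift \<alpha>\<close> at time \<open>n + 1\<close>. Compactness of the sequence space makes the shrinking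
  uniform in \<open>\<alpha>\<close> too. Hence two such points are close, uniformly in time, iff their itineraries
  share a long prefix; the converse direction uses the positive distance between the \<open>V i\<close>.

  For the entropy, a Lebesgue number bounds the size of subcovers by the number of admissible words
  of length \<open>n + K\<close>, whereas the cover by small balls separates all words of length \<open>n\<close>; both
  numbers are entry sums of matrix powers and grow at rate \<open>ln (matrix_rho A)\<close>.

  For chaos, two distinct loops of equal length through \<open>i\<^sub>0\<close> encode the bits of a binary sequence
  which is constant on rapidly growing time blocks. A pair of different codes agrees on
  infinitely many blocks and differs on infinitely many, and each block is so long that it
  determines the frequencies up to its end.
\<close>

subsection \<open>Nonautonomous iterates and hyperspaces\<close>

lemma iterates_add: "iterates g (n + k) l (iterates g n k x) = iterates g n (k + l) x"
  by (induction l) (simp_all add: add.assoc)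

lemma continuous_on_iterates:
  assumes "\<And>n. continuous_on UNIV (f n)"
  shows "continuous_on UNIV (iterates f n k)"
proof (induction k)
  case (Suc k)
  then show ?case
    using assms continuous_on_compose continuous_on_subset by (metis iterates.simps(2) subset_UNIV)
qed (simp add: continuous_on_id)

lemma equi_continuous_iterates:
  assumes "equi_continuous d (\<lambda>n. UNIV) d f"
  shows "equi_continuous d (\<lambda>n. UNIV) d (\<lambda>n. iterates f n k)"
proof (induction k)
  case 0
  then show ?case by (auto simp: equi_continuous_def)
next
  case (Suc k)
  show ?case
    unfolding equi_continuous_def
  proof (intro allI impI)
    fix \<epsilon> :: real assume "\<epsilon> > 0"
    then obtain \<delta> where "\<delta> > 0" and \<delta>: "\<And>n x y. d x y < \<delta> \<Longrightarrow> d (f n x) (f n y) < \<epsilon>"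
      using assms unfolding equi_continuous_def by (metis UNIV_I)
    obtain \<gamma> where "\<gamma> > 0"
      and "\<And>n x y. d x y < \<gamma> \<Longrightarrow> d (iterates f n k x) (iterates f n k y) < \<delta>"
      using Suc \<open>\<delta> > 0\<close> unfolding equi_continuous_def by (metis UNIV_I)
    then show "\<exists>\<gamma>>0. \<forall>n. \<forall>x\<in>UNIV. \<forall>y\<in>UNIV. d x y < \<gamma> \<longrightarrow>
        d (iterates f n (Suc k) x) (iterates f n (Suc k) y) < \<epsilon>"
      using \<delta> by (metis comp_apply iterates.simps(2))
  qed
qed

lemma iterates_induced_singleton: "iterates (induced f) i n {x} = {iterates f i n x}"
  by (induction n) (simp_all add: induced_def)

lemma singleton_in_nonempty_compacts [simp]: "{x} \<in> nonempty_compacts"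
  by (simp add: nonempty_compacts_def)

lemma hausdorff_dist_singleton [simp]: "hausdorff_dist {x} {y} = dist x y"
  by (simp add: hausdorff_dist_def dist_commute)

text \<open>The map to singletons is isometric. Open covers of the hyperspace can thus be pulled
  back to the base space, and compactness pushed forward.\<close>

lemma open_singleton_vimage:
  assumes "openin hausdorff_topology U"
  shows "open ((\<lambda>x::'a::metric_space. {x}) -` U)"
  unfolding open_dist
proof
  interpret H: Metric_space nonempty_compacts "hausdorff_dist :: 'a set \<Rightarrow> _"
    by (rule Metric_space_hausdorff)
  fix x :: 'a assume "x \<in> (\<lambda>x. {x}) -` U"
  then obtain r where "r > 0" "H.mball {x} r \<subseteq> U"
    using assms by (auto simp: H.openin_mtopology)
  then show "\<exists>e>0. \<forall>y. dist y x < e \<longrightarrow> y \<in> (\<lambda>x. {x}) -` U"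
    by (intro exI[of _ r]) (auto simp: subset_iff dist_commute)
qed

lemma compactin_singletons:
  assumes "compact X"
  shows "compactin hausdorff_topology ((\<lambda>x. {x}) ` X)"
proof (rule image_compactin)
  show "compactin euclidean X" using assms by simp
  show "continuous_map euclidean hausdorff_topology (\<lambda>x. {x :: 'a})"
    using open_singleton_vimage Metric_space.topspace_mtopology[OF Metric_space_hausdorff]
    by (auto simp: continuous_map_def vimage_def)
qed

text \<open>The distance is a Lebesgue number of the cover by sets that omit all \<open>V j\<close>
  but one: two points so close lie in a common member, which meets at most one of the
  \<open>V j\<close>.\<close>

lemma disjoint_closed_separation:
  fixes V :: "'i::finite \<Rightarrow> 'a::metric_space set"
  assumes "compact (UNIV :: 'a set)" "\<And>i. closed (V i)" "\<And>i j. i \<noteq> j \<Longrightarrow> V i \<inter> V j = {}"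
  obtains \<eta> where "\<eta> > 0" "\<And>x y i j. dist x y < \<eta> \<Longrightarrow> x \<in> V i \<Longrightarrow> y \<in> V j \<Longrightarrow> i = j"
proof -
  let ?U = "\<lambda>i. - (\<Union>j\<in>UNIV - {i}. V j)"
  have cover: "UNIV \<subseteq> \<Union>(range ?U)"
  proof
    fix x
    show "x \<in> \<Union>(range ?U)" by (cases "\<exists>i. x \<in> V i") (use assms(3) in blast)+
  qed
  have "open (?U i)" for i
    using assms(2) by (intro open_Compl closed_UN) auto
  then have op: "open U" if "U \<in> range ?U" for U using that by auto
  obtain \<delta> where "\<delta> > 0" and \<delta>: "\<And>x. x \<in> UNIV \<Longrightarrow> \<exists>U\<in>range ?U. ball x \<delta> \<subseteq> U"
    using Heine_Borel_lemma[OF assms(1) cover op] by blast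
  have "i = j" if "dist x y < \<delta>" "x \<in> V i" "y \<in> V j" for x y i j
  proof -
    obtain k where "ball x \<delta> \<subseteq> ?U k" using \<delta>[of x] by auto
    moreover have "x \<in> ball x \<delta>" "y \<in> ball x \<delta>" using that(1) \<open>\<delta> > 0\<close> by auto
    ultimately have "x \<in> ?U k" "y \<in> ?U k" by blast+
    then have "i = k" "j = k" using that(2,3) by auto
    then show ?thesis by simp
  qed
  then show ?thesis using that \<open>\<delta> > 0\<close> by blast
qed

section \<open>Bounds for minimal subcovers\<close>

lemma min_subcover_card_le:
  assumes "\<D> \<subseteq> \<B>" "finite \<D>" "\<Union>\<D> = Y"
  shows "min_subcover_card \<B> Y \<le> card \<D>"
  unfolding min_subcover_card_def using assms by (intro cInf_lower) auto

text \<open>The first premise makes the set of cardinalities nonempty; without it a lower bound for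
  the members says nothing about the infimum.\<close>

lemma min_subcover_card_ge:
  assumes "\<exists>\<D>\<subseteq>\<B>. finite \<D> \<and> \<Union>\<D> = Y"
    and "\<And>\<D>. \<lbrakk>\<D> \<subseteq> \<B>; finite \<D>; \<Union>\<D> = Y\<rbrakk> \<Longrightarrow> m \<le> card \<D>"
  shows "m \<le> min_subcover_card \<B> Y"
  unfolding min_subcover_card_def using assms by (intro cInf_greatest) auto

subsection \<open>Symbol sequences\<close>

lemma summable_symbol_dist: "summable (\<lambda>i. (if \<alpha> i = \<beta> i then 0 else 1) / 2 ^ i :: real)"
proof (rule summable_comparison_test')
  show "summable (\<lambda>i. (1/2) ^ i :: real)" by (rule summable_geometric) simp
  show "norm ((if \<alpha> i = \<beta> i then 0 else 1) / 2 ^ i :: real) \<le> (1/2) ^ i" if "0 \<le> i" for i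
    by (simp add: power_one_over)
qed

text \<open>Only the tail of the series from index \<open>K\<close> on survives, and a geometric
  series dominates it.\<close>

lemma symbol_dist_le:
  assumes "\<And>i. i < K \<Longrightarrow> \<alpha> i = \<beta> i"
  shows "symbol_dist \<alpha> \<beta> \<le> 2 / 2 ^ K"
proof -
  let ?t = "\<lambda>i. (if \<alpha> i = \<beta> i then 0 else 1) / 2 ^ i :: real"
  have "symbol_dist \<alpha> \<beta> = (\<Sum>i. ?t (i + K)) + (\<Sum>i<K. ?t i)"
    unfolding symbol_dist_def by (rule suminf_split_initial_segment[OF summable_symbol_dist])
  also have "(\<Sum>i<K. ?t i) = 0" using assms by simp
  also have "(\<Sum>i. ?t (i + K)) \<le> (\<Sum>i. (1/2) ^ i * (1 / 2 ^ K))"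
    by (intro suminf_le summable_mult2 summable_geometric summable_ignore_initial_segment summable_symbol_dist)
       (auto simp: power_add field_simps)
  also have "\<dots> = 2 / 2 ^ K"
    by (subst suminf_mult2[symmetric]) (auto simp: suminf_geometric summable_geometric)
  finally show ?thesis by simp
qed

text \<open>A single disagreement at an index up to \<open>K\<close> already contributes at least
  \<open>1 / 2 ^ K\<close>.\<close>

lemma symbol_dist_less_imp_eq:
  assumes "symbol_dist \<alpha> \<beta> < 1 / 2 ^ K" "i \<le> K"
  shows "\<alpha> i = \<beta> i"
proof (rule ccontr)
  let ?t = "\<lambda>i. (if \<alpha> i = \<beta> i then 0 else 1) / 2 ^ i :: real"
  assume "\<alpha> i \<noteq> \<beta> i"
  then have "1 / 2 ^ K \<le> ?t i" using assms(2) by (simp add: field_simps)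
  also have "?t i = (\<Sum>j\<in>{i}. ?t j)" by simp
  also have "\<dots> \<le> symbol_dist \<alpha> \<beta>"
    unfolding symbol_dist_def by (intro sum_le_suminf summable_symbol_dist) auto
  finally show False using assms(1) by simp
qed

text \<open>The fan theorem, that is, compactness of the space of all symbol sequences.\<close>

lemma finite_cylinder_cover:
  fixes K :: "(nat \<Rightarrow> 'n::finite) \<Rightarrow> nat"
  obtains F where "finite F" "\<And>\<beta>. \<exists>\<alpha>\<in>F. \<forall>i\<le>K \<alpha>. \<beta> i = \<alpha> i"
proof -
  let ?T = "product_topology (\<lambda>_::nat. discrete_topology (UNIV :: 'n set)) UNIV"
  let ?C = "\<lambda>\<alpha>. {\<beta>. \<forall>i\<le>K \<alpha>. \<beta> i = \<alpha> i}"
  have "compact_space ?T"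
    by (auto simp: compact_space_product_topology compact_space_discrete_topology)
  moreover have "openin ?T (?C \<alpha>)" for \<alpha>
  proof -
    \<comment> \<open>A cylinder is a box that constrains finitely many coordinates, hence open in
      the product topology.\<close>
    have "?C \<alpha> = (\<Pi>\<^sub>E i\<in>UNIV. if i \<le> K \<alpha> then {\<alpha> i} else UNIV)"
      by (auto simp: PiE_def Pi_def split: if_splits)
    moreover have "openin ?T \<dots>"
      unfolding openin_PiE_gen
      by (auto intro: finite_subset[of _ "{..K \<alpha>}"] split: if_splits)
    ultimately show ?thesis by simp
  qed
  ultimately have "\<exists>\<F>. finite \<F> \<and> \<F> \<subseteq> range ?C \<and> topspace ?T \<subseteq> \<Union>\<F>"
    unfolding compact_space_alt
    by (elim allE[of _ "range ?C"]) (auto intro: order.refl)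
  then obtain \<F> where \<F>: "finite \<F>" "\<F> \<subseteq> range ?C" "topspace ?T \<subseteq> \<Union>\<F>" by blast
  obtain F where F: "finite F" "\<F> = ?C ` F" using finite_subset_image[OF \<F>(1,2)] by blast
  have "\<exists>\<alpha>\<in>F. \<forall>i\<le>K \<alpha>. \<beta> i = \<alpha> i" for \<beta>
  proof -
    have "\<beta> \<in> \<Union>\<F>" using \<F>(3) by auto
    then show ?thesis unfolding F(2) by simp
  qed
  then show ?thesis using F(1) by (rule that[rotated])
qed

lemma itinerary_set_iff:
  "x \<in> itinerary_set f V \<alpha> m n \<longleftrightarrow> (\<forall>k\<le>m. iterates f n k x \<in> V (\<alpha> k) (n + k))"
  by (auto simp: itinerary_set_def)

subsection \<open>Admissible words and the spectral radius\<close>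

text \<open>The index counts edges, not letters, so that these words correspond to the
  \<open>n\<close>-th matrix power.\<close>

definition paths :: "nat ^ 'n ^ 'n \<Rightarrow> nat \<Rightarrow> 'n list set" where
  "paths A n = {w. length w = Suc n \<and> (\<forall>k<n. A $ (w ! k) $ (w ! Suc k) = 1)}"

lemma finite_paths: "finite (paths (A :: nat ^ 'n ^ 'n) n)"
  by (rule finite_subset[OF _ finite_lists_length_eq[of UNIV "Suc n"]]) (auto simp: paths_def)

lemma snoc_in_paths_iff:
  assumes "length w = Suc n"
  shows "w @ [j] \<in> paths A (Suc n) \<longleftrightarrow> w \<in> paths A n \<and> A $ last w $ j = 1"
proof -
  have "last w = w ! n" using assms by (cases w rule: rev_cases) auto
  then show ?thesis
    using assms by (auto simp: paths_def nth_append All_less_Suc)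
qed

text \<open>Splitting by the last letter but one mirrors the recursion
  \<open>matrix_pow A k ** A\<close>.\<close>

lemma paths_Suc_last:
  "{w \<in> paths A (Suc n). last w = j} =
    (\<Union>i\<in>{i. A $ i $ j = 1}. (\<lambda>w. w @ [j]) ` {w \<in> paths A n. last w = i})" (is "?L = ?R")
proof (rule set_eqI)
  fix w
  show "w \<in> ?L \<longleftrightarrow> w \<in> ?R"
  proof (cases w rule: rev_cases)
    case Nil
    then show ?thesis by (auto simp: paths_def)
  next
    case (snoc v k)
    then show ?thesis
      using snoc_in_paths_iff[of v n k A] by (auto simp: paths_def)
  qed
qed

lemma card_paths_last:
  fixes A :: "nat ^ 'n ^ 'n"
  assumes "\<And>i j. A $ i $ j \<in> {0, 1}"
  shows "card {w \<in> paths A n. last w = j} = (\<Sum>i\<in>UNIV. matrix_pow A n $ i $ j)"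
proof (induction n arbitrary: j)
  case 0
  have "{w \<in> paths A 0. last w = j} = {[j]}"
    by (auto simp: paths_def length_Suc_conv)
  then show ?case by (simp add: mat_def)
next
  case (Suc n)
  have "card {w \<in> paths A (Suc n). last w = j} =
      (\<Sum>i\<in>{i. A $ i $ j = 1}. card ((\<lambda>w. w @ [j]) ` {w \<in> paths A n. last w = i}))"
    unfolding paths_Suc_last by (rule card_UN_disjoint) (auto simp: finite_paths)
  also have "\<dots> = (\<Sum>i\<in>{i. A $ i $ j = 1}. card {w \<in> paths A n. last w = i})"
    by (intro sum.cong card_image inj_onI) auto
  \<comment> \<open>As entries are 0 or 1, restricting the sum to predecessors of \<open>j\<close>
    is the same as weighting by the entry.\<close>
  also have "\<dots> = (\<Sum>i\<in>UNIV. card {w \<in> paths A n. last w = i} * A $ i $ j)"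
    using assms by (intro sum.mono_neutral_cong_left) force+
  also have "\<dots> = (\<Sum>i\<in>UNIV. \<Sum>k\<in>UNIV. matrix_pow A n $ k $ i * A $ i $ j)"
    by (simp add: Suc.IH sum_distrib_right)
  also have "\<dots> = (\<Sum>k\<in>UNIV. matrix_pow A (Suc n) $ k $ j)"
    by (subst sum.swap) (simp add: matrix_matrix_mult_def)
  finally show ?case .
qed

lemma card_paths:
  fixes A :: "nat ^ 'n ^ 'n"
  assumes "\<And>i j. A $ i $ j \<in> {0, 1}"
  shows "card (paths A n) = entry_sum (matrix_pow A n)"
proof -
  have "card (paths A n) = card (\<Union>j\<in>UNIV. {w \<in> paths A n. last w = j})"
    by (rule arg_cong[of _ _ card]) auto
  also have "\<dots> = (\<Sum>j\<in>UNIV. card {w \<in> paths A n. last w = j})"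
    by (rule card_UN_disjoint) (auto simp: finite_paths)
  also have "\<dots> = entry_sum (matrix_pow A n)"
    unfolding entry_sum_def card_paths_last[OF assms] by (rule sum.swap)
  finally show ?thesis .
qed

text \<open>A positive entry of a product has a positive summand, whose middle index is the last
  letter but one. Unlike the counting lemma, this keeps track of the first letter.\<close>

lemma path_of_matrix_pow_pos:
  fixes A :: "nat ^ 'n ^ 'n"
  assumes "\<And>i j. A $ i $ j \<in> {0, 1}" "matrix_pow A k $ i $ j > 0"
  obtains w where "w \<in> paths A k" "hd w = i" "last w = j"
proof -
  have "\<exists>w\<in>paths A k. hd w = i \<and> last w = j"
    using assms(2)
  proof (induction k arbitrary: j)
    case 0
    then show ?case by (intro bexI[of _ "[i]"]) (auto simp: mat_def paths_def split: if_splits)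
  next
    case (Suc k)
    then have "(\<Sum>l\<in>UNIV. matrix_pow A k $ i $ l * A $ l $ j) > 0"
      by (simp add: matrix_matrix_mult_def)
    then obtain l where l: "matrix_pow A k $ i $ l > 0" "A $ l $ j > 0"
      by (metis (no_types, lifting) sum.neutral less_irrefl gr0I mult_is_0)
    then obtain w where w: "w \<in> paths A k" "hd w = i" "last w = l" using Suc.IH by blast
    moreover have "A $ l $ j = 1" using l(2) assms(1)[of l j] by auto
    moreover have "length w = Suc k" using w by (simp add: paths_def)
    ultimately show ?case
      using snoc_in_paths_iff[of w k j A] by (intro bexI[of _ "w @ [j]"]) (auto simp: hd_append)
  qed
  then show ?thesis using that by blast
qed

lemma transition_matrix_entry: "transition_matrix A \<Longrightarrow> A $ i $ j \<in> {0, 1}"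
  by (simp add: transition_matrix_def)

lemma transition_matrix_successor:
  fixes A :: "nat ^ 'n ^ 'n"
  assumes "transition_matrix A"
  shows "\<exists>j. A $ i $ j = 1"
proof -
  have "(\<Sum>j\<in>UNIV. A $ i $ j) \<noteq> 0"
    using assms unfolding transition_matrix_def by (metis not_one_le_zero)
  then obtain j where "A $ i $ j \<noteq> 0" by (metis sum.neutral)
  then show ?thesis
    using transition_matrix_entry[OF assms, of i j] by auto
qed

lemma transition_matrix_predecessor:
  fixes A :: "nat ^ 'n ^ 'n"
  assumes "transition_matrix A"
  shows "\<exists>i. A $ i $ j = 1"
proof -
  have "(\<Sum>i\<in>UNIV. A $ i $ j) \<noteq> 0"
    using assms unfolding transition_matrix_def by (metis not_one_le_zero)
  then obtain i where "A $ i $ j \<noteq> 0" by (metis sum.neutral)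
  then show ?thesis
    using transition_matrix_entry[OF assms, of i j] by auto
qed

section \<open>The subshift and its finite words\<close>

lemma shift_in_subshift: "\<alpha> \<in> subshift A \<Longrightarrow> shift \<alpha> \<in> subshift A"
  by (simp add: subshift_def shift_def)

text \<open>Surjectivity holds because no column of \<open>A\<close> vanishes: a predecessor of the
  first letter can be prepended.\<close>

lemma shift_image_subshift:
  assumes "transition_matrix A"
  shows "shift ` subshift A = subshift A"
proof
  show "subshift A \<subseteq> shift ` subshift A"
  proof
    fix \<alpha> assume "\<alpha> \<in> subshift A"
    obtain i where "A $ i $ \<alpha> 0 = 1" using transition_matrix_predecessor[OF assms] by blast
    with \<open>\<alpha> \<in> subshift A\<close> have "case_nat i \<alpha> \<in> subshift A"
      by (auto simp: subshift_def split: nat.split)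
    moreover have "shift (case_nat i \<alpha>) = \<alpha>" by (simp add: shift_def)
    ultimately show "\<alpha> \<in> shift ` subshift A" by force
  qed
qed (auto intro: shift_in_subshift)

lemma prefixes_subshift:
  assumes "transition_matrix A"
  shows "(\<lambda>\<alpha>. map \<alpha> [0..<Suc n]) ` subshift A = paths A n"
proof
  show "(\<lambda>\<alpha>. map \<alpha> [0..<Suc n]) ` subshift A \<subseteq> paths A n"
    by (auto simp: subshift_def paths_def simp del: upt_Suc)
  show "paths A n \<subseteq> (\<lambda>\<alpha>. map \<alpha> [0..<Suc n]) ` subshift A"
  proof
    fix w assume w: "w \<in> paths A n"
    obtain s where s: "\<And>i. A $ i $ s i = 1" using transition_matrix_successor[OF assms] by metis
    \<comment> \<open>As no row of \<open>A\<close> vanishes, the word continues forever by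
      iterating a choice of successor on its last letter.\<close>
    define \<alpha> where "\<alpha> k = (if k \<le> n then w ! k else (s ^^ (k - n)) (w ! n))" for k
    have "A $ \<alpha> k $ \<alpha> (Suc k) = 1" for k
    proof (cases "k < n")
      case True
      then show ?thesis using w by (simp add: \<alpha>_def paths_def)
    next
      case False
      then show ?thesis using s by (auto simp: \<alpha>_def Suc_diff_le)
    qed
    moreover have "map \<alpha> [0..<Suc n] = w"
      using w by (intro nth_equalityI) (auto simp: \<alpha>_def paths_def simp del: upt_Suc)
    ultimately show "w \<in> (\<lambda>\<alpha>. map \<alpha> [0..<Suc n]) ` subshift A"
      by (auto simp: subshift_def intro!: image_eqI[of _ _ \<alpha>])
  qed
qed

lemma subshift_nonempty:
  assumes "transition_matrix A"
  shows "subshift A \<noteq> {}"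
proof -
  have "[undefined] \<in> paths A 0" by (simp add: paths_def)
  then show ?thesis using prefixes_subshift[OF assms, of 0] by auto
qed

section \<open>Subadditivity and the growth rate of the number of words\<close>

lemma Fekete:
  fixes a :: "nat \<Rightarrow> real"
  assumes sub: "\<And>m n. a (m + n) \<le> a m + a n" and nonneg: "\<And>n. a n \<ge> 0"
  shows "convergent (\<lambda>n. a n / real n)"
proof -
  define L where "L = (INF n\<in>{1..}. a n / real n)"
  have bdd: "bdd_below ((\<lambda>n. a n / real n) ` {1..})"
    by (rule bdd_belowI[of _ 0]) (auto simp: nonneg)
  \<comment> \<open>Division of \<open>n\<close> with remainder by \<open>m\<close> will compare
    \<open>a n / n\<close> with \<open>a m / m\<close>, so that the infimum of the quotients becomes
    their limit.\<close>
  have mult: "a (q * m + r) \<le> real q * a m + a r" for q m r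
  proof (induction q)
    case (Suc q)
    then show ?case using sub[of m "q * m + r"] by (simp add: algebra_simps)
  qed simp
  have "(\<lambda>n. a n / real n) \<longlonglongrightarrow> L"
  proof (rule LIMSEQ_I)
    fix \<epsilon> :: real assume "\<epsilon> > 0"
    then have "\<exists>m\<in>{1..}. a m / real m < L + \<epsilon> / 2"
      using cINF_less_iff[OF _ bdd, of "L + \<epsilon> / 2"] by (auto simp: L_def)
    then obtain m where m: "m \<ge> 1" "a m / real m < L + \<epsilon> / 2" by auto
    \<comment> \<open>By nonnegativity this sum bounds every remainder term
      \<open>a (n mod m)\<close>.\<close>
    define B where "B = (\<Sum>r<m. a r)"
    obtain n0 :: nat where n0: "n0 > 2 * B / \<epsilon>" using reals_Archimedean2 by blast
    have "norm (a n / real n - L) < \<epsilon>" if "n \<ge> Suc n0" for n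
    proof -
      have n: "real n > 0" using that by simp
      have "a (n mod m) \<le> B"
        unfolding B_def using m(1) nonneg by (intro member_le_sum) auto
      then have "a n \<le> real (n div m) * a m + B"
        using mult[of "n div m" m "n mod m"] by simp
      also have "real (n div m) * a m \<le> real n / real m * a m"
        by (intro mult_right_mono nonneg of_nat_div_le_of_nat)
      finally have "a n / real n \<le> a m / real m + B / real n"
        using n m(1) by (simp add: field_simps)
      moreover have "B / real n < \<epsilon> / 2"
      proof -
        have "2 * B / \<epsilon> < real n" using n0 that by linarith
        then show ?thesis using \<open>\<epsilon> > 0\<close> n by (simp add: field_simps)
      qed
      moreover have "L \<le> a n / real n"
        unfolding L_def using that by (intro cINF_lower[OF bdd]) auto
      ultimately show ?thesis using m(2) unfolding real_norm_def by linarith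
    qed
    then show "\<exists>no. \<forall>n\<ge>no. norm (a n / real n - L) < \<epsilon>" by blast
  qed
  then show ?thesis by (rule convergentI)
qed

lemma matrix_pow_add: "matrix_pow A (m + n) = matrix_pow A m ** matrix_pow A n"
  by (induction n) (simp_all add: matrix_mul_assoc del: One_nat_def)

text \<open>Each row sum of \<open>C\<close> is at most the sum of all its entries, since these are
  nonnegative. Logarithms of entry sums of powers become subadditive in the exponent.\<close>

lemma entry_sum_mult_le: "entry_sum (B ** C) \<le> entry_sum B * entry_sum C"
proof -
  have row: "(\<Sum>j\<in>UNIV. C $ k $ j) \<le> entry_sum C" for k
    unfolding entry_sum_def by (rule member_le_sum[of k UNIV "\<lambda>k. \<Sum>j\<in>UNIV. C $ k $ j"]) auto
  have "entry_sum (B ** C) = (\<Sum>i\<in>UNIV. \<Sum>j\<in>UNIV. \<Sum>k\<in>UNIV. B $ i $ k * C $ k $ j)"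
    by (simp add: entry_sum_def matrix_matrix_mult_def)
  also have "\<dots> = (\<Sum>i\<in>UNIV. \<Sum>k\<in>UNIV. B $ i $ k * (\<Sum>j\<in>UNIV. C $ k $ j))"
    unfolding sum_distrib_left by (intro sum.cong refl sum.swap)
  also have "\<dots> \<le> (\<Sum>i\<in>UNIV. \<Sum>k\<in>UNIV. B $ i $ k * entry_sum C)"
    by (intro sum_mono mult_left_mono row) auto
  also have "\<dots> = entry_sum B * entry_sum C"
    by (simp add: entry_sum_def[of B] sum_distrib_right)
  finally show ?thesis .
qed

lemma entry_sum_matrix_pow_pos:
  assumes "transition_matrix A"
  shows "entry_sum (matrix_pow A n) > 0"
  using subshift_nonempty[OF assms] prefixes_subshift[OF assms, of n] finite_paths[of A n]
  by (auto simp flip: card_paths[OF transition_matrix_entry[OF assms]] simp: card_gt_0_iff)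

text \<open>As \<open>matrix_rho\<close> is defined by \<open>lim\<close>, convergence has to be
  proved before anything can be said about its value; it follows from submultiplicativity.\<close>

lemma growth_rate_tendsto_ln_matrix_rho:
  assumes "transition_matrix A"
  shows "(\<lambda>n. ln (real (entry_sum (matrix_pow A n))) / real n) \<longlonglongrightarrow> ln (matrix_rho A)"
proof -
  define s where "s n = real (entry_sum (matrix_pow A n))" for n
  have pos: "s n \<ge> 1" for n
    unfolding s_def using entry_sum_matrix_pow_pos[OF assms, of n] by linarith
  have "convergent (\<lambda>n. ln (s n) / real n)"
  proof (rule Fekete)
    show "ln (s n) \<ge> 0" for n using pos by simp
    show "ln (s (m + n)) \<le> ln (s m) + ln (s n)" for m n
    proof -
      have "s (m + n) \<le> s m * s n"
        unfolding s_def matrix_pow_add by (metis entry_sum_mult_le of_nat_le_iff of_nat_mult)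
      then have "ln (s (m + n)) \<le> ln (s m * s n)"
        using pos[of "m + n"] by simp
      then show ?thesis using pos[of m] pos[of n] by (simp add: ln_mult)
    qed
  qed
  then obtain L where L: "(\<lambda>n. ln (s n) / real n) \<longlonglongrightarrow> L" by (auto simp: convergent_def)
  have "(\<lambda>n. root n (s n)) \<longlonglongrightarrow> exp L"
  proof (rule Lim_transform_eventually[OF tendsto_exp[OF L]])
    \<comment> \<open>The identity holds only for positive \<open>n\<close>: at \<open>n = 0\<close>
      the left side is 1, while \<open>root 0\<close> is 0.\<close>
    show "\<forall>\<^sub>F n in sequentially. exp (ln (s n) / real n) = root n (s n)"
      using eventually_gt_at_top[of 0]
    proof eventually_elim
      case (elim n)
      then show ?case using pos[of n] by (simp add: root_powr_inverse powr_def)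
    qed
  qed
  then have "matrix_rho A = exp L" unfolding matrix_rho_def s_def by (rule limI)
  then show ?thesis using L by (simp add: s_def)
qed

subsection \<open>Scrambled symbol sequences\<close>

text \<open>In this form paths can be glued by the append rules for
  \<open>successively\<close>.\<close>

lemma paths_iff_successively:
  "w \<in> paths A n \<longleftrightarrow> length w = Suc n \<and> successively (\<lambda>i j. A $ i $ j = 1) w"
  by (auto simp: paths_def successively_conv_nth)

lemma two_successors:
  fixes A :: "nat ^ 'n ^ 'n"
  assumes "transition_matrix A" "(\<Sum>j\<in>UNIV. A $ i $ j) \<ge> 2"
  obtains j k where "A $ i $ j = 1" "A $ i $ k = 1" "j \<noteq> k"
proof -
  obtain j where j: "A $ i $ j = 1" using transition_matrix_successor[OF assms(1)] by blast
  have "(\<Sum>k\<in>UNIV. A $ i $ k) = 1 + (\<Sum>k\<in>UNIV - {j}. A $ i $ k)"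
    by (subst sum.remove[of UNIV j]) (auto simp: j)
  with assms(2) have "(\<Sum>k\<in>UNIV - {j}. A $ i $ k) \<noteq> 0" by linarith
  then obtain k where "k \<in> UNIV - {j}" "A $ i $ k \<noteq> 0" by (metis (no_types, lifting) sum.neutral)
  then show ?thesis using that j transition_matrix_entry[OF assms(1), of i k] by auto
qed

text \<open>Two loops through \<open>i\<close> that leave it along different edges are made equally long by
  traversing both of them, in the two possible orders.\<close>

lemma two_loops:
  fixes A :: "nat ^ 'n ^ 'n"
  assumes "transition_matrix A" "irreducible_matrix A" "(\<Sum>j\<in>UNIV. A $ i $ j) \<ge> 2"
  obtains L u v where "L \<ge> 2" "u \<in> paths A L" "v \<in> paths A L" "hd u = i" "hd v = i"
    "last u = i" "last v = i" "u ! 1 \<noteq> v ! 1"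
proof -
  obtain j k where jk: "A $ i $ j = 1" "A $ i $ k = 1" "j \<noteq> k"
    by (rule two_successors[OF assms(1,3)])
  have return: "\<exists>m. \<exists>p\<in>paths A m. hd p = l \<and> last p = i" for l
    using assms(2) path_of_matrix_pow_pos[OF transition_matrix_entry[OF assms(1)]]
    unfolding irreducible_matrix_def by metis
  obtain m p n q where p: "p \<in> paths A m" "hd p = j" "last p = i"
    and q: "q \<in> paths A n" "hd q = k" "last q = i"
    using return[of j] return[of k] by blast
  have ne: "p \<noteq> []" "q \<noteq> []" using p q by (auto simp: paths_def)
  show ?thesis
  proof (rule that)
    \<comment> \<open>The words have \<open>1 + (m + 1) + (n + 1)\<close> letters, hence
      \<open>m + n + 2\<close> edges. The joints are the edges from \<open>i\<close> to
      \<open>j\<close> and to \<open>k\<close>, because both \<open>p\<close> and \<open>q\<close>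
      return to \<open>i\<close>.\<close>
    show "i # p @ q \<in> paths A (m + n + 2)" "i # q @ p \<in> paths A (m + n + 2)"
      using p q jk ne by (auto simp: paths_iff_successively successively_append_iff successively_Cons)
    show "last (i # p @ q) = i" "last (i # q @ p) = i" using p q ne by auto
    have "(i # p @ q) ! 1 = j" "(i # q @ p) ! 1 = k"
      using p q ne by (auto simp: hd_conv_nth nth_append)
    then show "(i # p @ q) ! 1 \<noteq> (i # q @ p) ! 1" using jk(3) by simp
  qed auto
qed

section \<open>From binary codes to symbol sequences\<close>

definition concat_loops :: "nat \<Rightarrow> (bool \<Rightarrow> 'n list) \<Rightarrow> (nat \<Rightarrow> bool) \<Rightarrow> nat \<Rightarrow> 'n" where
  "concat_loops L W s k = W (s (k div L)) ! (k mod L)"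

lemma concat_loops_in_subshift:
  assumes "L > 0" "\<And>b. W b \<in> paths A L" "\<And>b. hd (W b) = i" "\<And>b. last (W b) = i"
  shows "concat_loops L W s \<in> subshift A"
proof -
  have len: "length (W b) = Suc L" for b using assms(2) by (auto simp: paths_def)
  have ends: "W b ! 0 = i" "W b ! L = i" for b
    using assms(3,4)[of b] len[of b] hd_conv_nth[of "W b"] last_conv_nth[of "W b"] by fastforce+
  \<comment> \<open>The last letter of a loop is never read by \<open>concat_loops\<close>, but it
    equals the first letter of the next loop, so the step across a boundary is still an edge inside
    one loop.\<close>
  have "concat_loops L W s (Suc k) = W (s (k div L)) ! Suc (k mod L)" for k
    using ends assms(1) by (auto simp: concat_loops_def div_Suc mod_Suc)
  moreover have "A $ (W b ! k) $ (W b ! Suc k) = 1" if "k < L" for b k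
    using assms(2)[of b] that by (auto simp: paths_def)
  ultimately show ?thesis
    using assms(1) by (simp add: subshift_def concat_loops_def)
qed

text \<open>A bit sequence that is constant on the time blocks \<open>{m!..<(m+1)!}\<close>. The value on block
  \<open>m\<close> is 0 or a bit of \<open>c\<close>, and the pairing function makes each of these choices for
  infinitely many \<open>m\<close>.\<close>

definition block_bit :: "(nat \<Rightarrow> bool) \<Rightarrow> nat \<Rightarrow> bool" where
  "block_bit c m = (case fst (prod_decode m) of 0 \<Rightarrow> False | Suc j \<Rightarrow> c j)"

text \<open>With factorial boundaries, block \<open>m\<close> is \<open>m\<close> times as long as
  the whole time before it. This forces the frequencies at its end towards 0 or 1.\<close>

definition spread :: "(nat \<Rightarrow> bool) \<Rightarrow> nat \<Rightarrow> bool" where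
  "spread c k = block_bit c (LEAST m. k < fact (Suc m))"

lemma spread_eq:
  assumes "fact m \<le> k" "k < fact (Suc m)"
  shows "spread c k = block_bit c m"
proof -
  have "(LEAST m. k < fact (Suc m)) = m"
  proof (rule Least_equality)
    fix m' assume "k < fact (Suc m')"
    with assms(1) have "(fact m :: nat) < fact (Suc m')" by (rule le_less_trans)
    then show "m \<le> m'" using fact_mono_nat[of "Suc m'" m] by (meson not_less not_less_eq_eq)
  qed fact
  then show ?thesis by (simp add: spread_def)
qed

lemma INFM_fst_prod_decode: "\<exists>\<^sub>\<infinity>m. fst (prod_decode m) = j"
proof -
  have "inj (\<lambda>l. prod_encode (j, l))" by (auto simp: inj_def)
  then have "infinite (range (\<lambda>l. prod_encode (j, l)))" by (rule range_inj_infinite)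
  moreover have "range (\<lambda>l. prod_encode (j, l)) \<subseteq> {m. fst (prod_decode m) = j}" by auto
  ultimately show ?thesis unfolding frequently_cofinite by (rule infinite_super[rotated])
qed

text \<open>Blocks whose index decodes to first component 0 carry \<open>False\<close> under every
  code.\<close>

lemma INFM_block_bit_eq: "\<exists>\<^sub>\<infinity>m. block_bit c m = block_bit c' m"
  by (rule frequently_mono[OF _ INFM_fst_prod_decode[of 0]]) (simp add: block_bit_def)

lemma INFM_block_bit_neq:
  assumes "c \<noteq> c'"
  shows "\<exists>\<^sub>\<infinity>m. block_bit c m \<noteq> block_bit c' m"
proof -
  obtain j where "c j \<noteq> c' j" using assms by auto
  then show ?thesis
    by (intro frequently_mono[OF _ INFM_fst_prod_decode[of "Suc j"]]) (auto simp: block_bit_def)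
qed

lemma uncountable_nat_bool: "uncountable (UNIV :: (nat \<Rightarrow> bool) set)"
proof
  assume "countable (UNIV :: (nat \<Rightarrow> bool) set)"
  then have "range (from_nat_into (UNIV :: (nat \<Rightarrow> bool) set)) = UNIV"
    by (intro range_from_nat_into) auto
  \<comment> \<open>Cantor's diagonal sequence, negated.\<close>
  then obtain n where "from_nat_into UNIV n = (\<lambda>k. \<not> from_nat_into UNIV k k)"
    by (metis UNIV_I imageE)
  then show False by metis
qed

text \<open>The first time of each block suffices: once \<open>m > K\<close>, the block is longer
  than \<open>K\<close>, so that time lies in the range of the premise.\<close>

lemma INFM_time_block:
  fixes L :: nat
  assumes "L > 0" "\<exists>\<^sub>\<infinity>m. \<forall>i. L * fact m \<le> i \<longrightarrow> i + K < L * fact (Suc m) \<longrightarrow> P i"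
  shows "\<exists>\<^sub>\<infinity>i. P i"
  unfolding INFM_nat_le
proof
  fix N
  obtain m where m: "m \<ge> max (Suc K) N"
    and P: "\<And>i. L * fact m \<le> i \<Longrightarrow> i + K < L * fact (Suc m) \<Longrightarrow> P i"
    using assms(2) unfolding INFM_nat_le by meson
  have ge: "1 * (m * 1) \<le> L * (m * fact m)" "1 * m \<le> L * fact m"
    using assms(1) fact_ge_self[of m] by (intro mult_mono fact_ge_1; simp)+
  have "L * fact (Suc m) = L * fact m + L * (m * fact m)" by (simp add: algebra_simps)
  then have "L * fact m + K < L * fact (Suc m)" "N \<le> L * fact m" using m ge by linarith+
  with P[of "L * fact m"] show "\<exists>n\<ge>N. P n" by blast
qed

text \<open>One bit governs \<open>L\<close> letters, whence the factor \<open>L\<close> in the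
  block boundaries. Where two codes carry the same bit, the sequences coincide; where the bits
  differ, any window of \<open>2 * L + 1\<close> letters inside the block meets the second letter of
  a loop, at which \<open>u\<close> and \<open>v\<close> differ.\<close>

lemma scrambled_symbol_sequences:
  fixes A :: "nat ^ 'n ^ 'n"
  assumes "transition_matrix A" "irreducible_matrix A" "(\<Sum>j\<in>UNIV. A $ i $ j) \<ge> 2"
  obtains L D where "L > 0" "D \<subseteq> subshift A" "uncountable D"
    "\<And>\<alpha> \<beta>. \<lbrakk>\<alpha> \<in> D; \<beta> \<in> D; \<alpha> \<noteq> \<beta>\<rbrakk> \<Longrightarrow>
      \<exists>\<^sub>\<infinity>m. \<forall>k. L * fact m \<le> k \<longrightarrow> k < L * fact (Suc m) \<longrightarrow> \<alpha> k = \<beta> k"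
    "\<And>\<alpha> \<beta>. \<lbrakk>\<alpha> \<in> D; \<beta> \<in> D; \<alpha> \<noteq> \<beta>\<rbrakk> \<Longrightarrow>
      \<exists>\<^sub>\<infinity>m. \<forall>k. L * fact m \<le> k \<longrightarrow> k + 2 * L < L * fact (Suc m) \<longrightarrow>
        (\<exists>l\<le>2 * L. \<alpha> (k + l) \<noteq> \<beta> (k + l))"
proof -
  obtain L u v where L: "L \<ge> 2" and uv: "u \<in> paths A L" "v \<in> paths A L" "hd u = i" "hd v = i"
    "last u = i" "last v = i" "u ! 1 \<noteq> v ! 1"
    by (rule two_loops[OF assms])
  define W where "W b = (if b then u else v)" for b
  define E where "E c = concat_loops L W (spread c)" for c
  have "L > 0" using L by simp
  have sub: "range E \<subseteq> subshift A"
    unfolding E_def using uv L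
    by (intro image_subsetI concat_loops_in_subshift[where i = i]) (auto simp: W_def)
  have agree: "\<exists>\<^sub>\<infinity>m. \<forall>k. L * fact m \<le> k \<longrightarrow> k < L * fact (Suc m) \<longrightarrow> E c k = E c' k" for c c'
  proof (rule frequently_mono[OF _ INFM_block_bit_eq[of c c']], intro allI impI)
    fix m k assume m: "block_bit c m = block_bit c' m" and k: "L * fact m \<le> k" "k < L * fact (Suc m)"
    have "fact m \<le> k div L" "k div L < fact (Suc m)"
      using k \<open>L > 0\<close> by (simp_all only: less_eq_div_iff_mult_less_eq div_less_iff_less_mult mult.commute)
    then show "E c k = E c' k" using m by (simp add: E_def concat_loops_def spread_eq[of m])
  qed
  have differ: "\<exists>\<^sub>\<infinity>m. \<forall>k. L * fact m \<le> k \<longrightarrow> k + 2 * L < L * fact (Suc m) \<longrightarrow>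
      (\<exists>l\<le>2 * L. E c (k + l) \<noteq> E c' (k + l))" if "c \<noteq> c'" for c c'
  proof (rule frequently_mono[OF _ INFM_block_bit_neq[OF that]], intro allI impI)
    fix m k assume m: "block_bit c m \<noteq> block_bit c' m"
      and k: "L * fact m \<le> k" "k + 2 * L < L * fact (Suc m)"
    \<comment> \<open>The first loop starting after time \<open>k\<close>. Its second letter is at
      \<open>L * q + 1\<close>, which is at most \<open>k + L + 1\<close> and so within the window
      because \<open>L \<ge> 2\<close>.\<close>
    define q where "q = Suc (k div L)"
    have "fact m \<le> k div L" "k div L + 2 < fact (Suc m)"
      using k \<open>L > 0\<close> div_less_iff_less_mult[of L "k + 2 * L" "fact (Suc m)"]
      by (simp_all add: less_eq_div_iff_mult_less_eq mult.commute del: fact_Suc)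
    then have q: "fact m \<le> q" "q < fact (Suc m)" by (simp_all add: q_def)
    have "(L * q + 1) div L = q" "(L * q + 1) mod L = 1"
      using L by (simp_all add: div_mult_self3 mod_mult_self3 del: Suc_eq_plus1 add_Suc_right)
    then have "E c (L * q + 1) \<noteq> E c' (L * q + 1)"
      using m uv(7) by (simp add: E_def concat_loops_def spread_eq[OF q] W_def)
    moreover have "k \<le> L * q + 1" "L * q + 1 \<le> k + 2 * L"
    proof -
      have "k = L * (k div L) + k mod L" "k mod L < L" using \<open>L > 0\<close> by simp_all
      then show "k \<le> L * q + 1" "L * q + 1 \<le> k + 2 * L" unfolding q_def mult_Suc_right using L by linarith+
    qed
    ultimately show "\<exists>l\<le>2 * L. E c (k + l) \<noteq> E c' (k + l)"
      by (intro exI[of _ "L * q + 1 - k"]) auto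
  qed
  \<comment> \<open>Distinct codes differ at some time, so there are as many sequences as
    codes.\<close>
  have "inj E"
  proof (rule injI, rule ccontr)
    fix c c' assume "E c = E c'" "c \<noteq> c'"
    then show False using INFM_time_block[OF \<open>L > 0\<close> differ[OF \<open>c \<noteq> c'\<close>]] by simp
  qed
  then have "uncountable (range E)"
    using uncountable_nat_bool countable_image_inj_eq by blast
  then show ?thesis
  proof (rule that[OF \<open>L > 0\<close> sub])
    show "\<exists>\<^sub>\<infinity>m. \<forall>k. L * fact m \<le> k \<longrightarrow> k < L * fact (Suc m) \<longrightarrow> \<alpha> k = \<beta> k"
      if "\<alpha> \<in> range E" "\<beta> \<in> range E" for \<alpha> \<beta>
      using that agree by blast
    show "\<exists>\<^sub>\<infinity>m. \<forall>k. L * fact m \<le> k \<longrightarrow> k + 2 * L < L * fact (Suc m) \<longrightarrow>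
        (\<exists>l\<le>2 * L. \<alpha> (k + l) \<noteq> \<beta> (k + l))"
      if "\<alpha> \<in> range E" "\<beta> \<in> range E" "\<alpha> \<noteq> \<beta>" for \<alpha> \<beta>
    proof -
      obtain c c' where "\<alpha> = E c" "\<beta> = E c'" using \<open>\<alpha> \<in> range E\<close> \<open>\<beta> \<in> range E\<close> by blast
      then show ?thesis using differ[of c c'] \<open>\<alpha> \<noteq> \<beta>\<close> by auto
    qed
  qed
qed

subsection \<open>Frequencies of times\<close>

definition frequency :: "(nat \<Rightarrow> bool) \<Rightarrow> nat \<Rightarrow> real" where
  "frequency P n = 1 / real n * (\<Sum>i<n. of_bool (P i))"

lemma frequency_nonneg: "0 \<le> frequency P n"
  by (simp add: frequency_def sum_nonneg)

lemma frequency_Not: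
  assumes "n > 0"
  shows "frequency (\<lambda>i. \<not> P i) n = 1 - frequency P n"
proof -
  have "(\<Sum>i<n. of_bool (\<not> P i)) = (\<Sum>i<n. 1 - of_bool (P i) :: real)"
    by (intro sum.cong) auto
  also have "\<dots> = real n - (\<Sum>i<n. of_bool (P i))"
    unfolding sum_subtractf by simp
  finally show ?thesis
    unfolding frequency_def using assms by (simp only: right_diff_distrib) simp
qed

lemma frequency_le_1: "frequency P n \<le> 1"
proof (cases "n = 0")
  case False
  then show ?thesis using frequency_nonneg[of "\<lambda>i. \<not> P i" n] frequency_Not[of n P] by linarith
qed (simp add: frequency_def)

text \<open>At the end \<open>n = L * fact (Suc m)\<close> of a good block, \<open>P\<close> can
  hold only before the block, which is a fraction \<open>1 / (m + 1)\<close> of all times, or at the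
  last \<open>K\<close> times. The total is at most \<open>(K + 1) / (m + 1)\<close>.\<close>

lemma frequency_small:
  assumes "L > 0" "\<exists>\<^sub>\<infinity>m. \<forall>i. L * fact m \<le> i \<longrightarrow> i + K < L * fact (Suc m) \<longrightarrow> \<not> P i" "c > 0"
  shows "\<exists>\<^sub>F n in sequentially. frequency P n < c"
  unfolding frequently_sequentially
proof
  fix N
  obtain M :: nat where M: "real (K + 1) / c < real M" using reals_Archimedean2 by blast
  obtain m where m: "m \<ge> max M N" and P: "\<And>i. L * fact m \<le> i \<Longrightarrow> i + K < L * fact (Suc m) \<Longrightarrow> \<not> P i"
    using assms(2) unfolding INFM_nat_le by meson
  define n where "n = L * fact (Suc m)"
  have "1 * (Suc m * 1) \<le> L * (Suc m * fact m)"
    using assms(1) by (intro mult_mono fact_ge_1) auto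
  then have n: "Suc m \<le> n" by (simp add: n_def)
  have "(\<Sum>i<n. of_bool (P i)) = real (card {i. i < n \<and> P i})"
    by (simp add: of_bool_def sum.If_cases lessThan_def Collect_conj_eq)
  also have "card {i. i < n \<and> P i} \<le> card ({..<L * fact m} \<union> {n - K..<n})"
  proof (intro card_mono subsetI)
    fix i assume "i \<in> {i. i < n \<and> P i}"
    then show "i \<in> {..<L * fact m} \<union> {n - K..<n}"
      using P[of i]
      by (cases "L * fact m \<le> i"; cases "i + K < L * fact (Suc m)") (auto simp: n_def simp del: fact_Suc)
  qed simp
  also have "\<dots> \<le> L * fact m + K"
    by (rule order.trans[OF card_Un_le]) auto
  finally have "frequency P n \<le> real (L * fact m + K) / real n"
    by (simp add: frequency_def divide_right_mono)
  also have "\<dots> = real (L * fact m) / real n + real K / real n"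
    by (simp add: add_divide_distrib)
  also have "real n = real (L * fact m) * real (Suc m)"
    by (simp add: n_def algebra_simps)
  then have "real (L * fact m) / real n = 1 / real (Suc m)"
    using assms(1) by simp
  also have "real K / real n \<le> real K / real (Suc m)"
    using n by (intro divide_left_mono) auto
  also have "1 / real (Suc m) + real K / real (Suc m) = real (K + 1) / real (Suc m)"
    by (simp add: add_divide_distrib)
  also have "\<dots> < c"
  proof -
    have "real (K + 1) / c < real (Suc m)" using M m by linarith
    then show ?thesis using assms(3) by (simp add: field_simps)
  qed
  finally show "\<exists>n\<ge>N. frequency P n < c" using n m by (intro exI[of _ n]) auto
qed

lemma liminf_frequency_eq_0:
  assumes "L > 0" "\<exists>\<^sub>\<infinity>m. \<forall>i. L * fact m \<le> i \<longrightarrow> i + K < L * fact (Suc m) \<longrightarrow> \<not> P i"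
  shows "liminf (\<lambda>n. ereal (frequency P n)) = 0"
proof (rule antisym)
  show "0 \<le> liminf (\<lambda>n. ereal (frequency P n))"
    by (rule Liminf_bounded) (simp add: frequency_nonneg)
  show "liminf (\<lambda>n. ereal (frequency P n)) \<le> 0"
  proof (rule ccontr)
    assume "\<not> ?thesis"
    then obtain c where "0 < ereal c" and c: "ereal c < liminf (\<lambda>n. ereal (frequency P n))"
      using ereal_dense2[of 0] by (auto simp: not_le)
    then have "\<exists>\<^sub>F n in sequentially. frequency P n < c"
      using frequency_small[OF assms] by simp
    moreover have "\<forall>\<^sub>F n in sequentially. ereal c < ereal (frequency P n)"
      by (rule less_LiminfD[OF c])
    then have "\<forall>\<^sub>F n in sequentially. \<not> frequency P n < c" by eventually_elim simp
    ultimately show False by (simp add: frequently_def)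
  qed
qed

lemma limsup_frequency_eq_1:
  assumes "L > 0" "\<exists>\<^sub>\<infinity>m. \<forall>i. L * fact m \<le> i \<longrightarrow> i + K < L * fact (Suc m) \<longrightarrow> P i"
  shows "limsup (\<lambda>n. ereal (frequency P n)) = 1"
proof (rule antisym)
  show "limsup (\<lambda>n. ereal (frequency P n)) \<le> 1"
    by (rule Limsup_bounded) (simp add: frequency_le_1)
  show "1 \<le> limsup (\<lambda>n. ereal (frequency P n))"
  proof (rule ccontr)
    assume "\<not> ?thesis"
    then obtain c where "ereal c < 1" and c: "limsup (\<lambda>n. ereal (frequency P n)) < ereal c"
      using ereal_dense2[of _ 1] by (auto simp: not_le)
    \<comment> \<open>Passing to the complement turns a frequency near 1 into a small one, with
      positive threshold \<open>1 - c\<close>.\<close>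
    then have "\<exists>\<^sub>F n in sequentially. frequency (\<lambda>i. \<not> P i) n < 1 - c"
      using assms by (intro frequency_small[where L = L and K = K]) auto
    moreover have "\<forall>\<^sub>F n in sequentially. ereal (frequency P n) < ereal c"
      by (rule Limsup_lessD[OF c])
    then have "\<forall>\<^sub>F n in sequentially. \<not> frequency (\<lambda>i. \<not> P i) n < 1 - c"
      using eventually_gt_at_top[of 0] by eventually_elim (simp add: frequency_Not)
    ultimately show False by (simp add: frequently_def)
  qed
qed

text \<open>Nonnegativity of the distance makes the lower end of the interval
  \<open>{0..<\<epsilon>}\<close> automatic.\<close>

lemma close_frequency_eq_frequency:
  assumes "\<And>i. e (iterates g 0 i x) (iterates g 0 i y) \<ge> 0"
  shows "close_frequency e g x y \<epsilon> = frequency (\<lambda>i. e (iterates g 0 i x) (iterates g 0 i y) < \<epsilon>)"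
  unfolding close_frequency_def frequency_def using assms
  by (intro ext arg_cong[of _ _ "\<lambda>s. _ * s"] sum.cong) (auto simp: indicator_def)

subsection \<open>Points with prescribed itinerary\<close>

locale itinerary_system =
  fixes f :: "nat \<Rightarrow> 'a::metric_space \<Rightarrow> 'a"
    and A :: "nat ^ 'n ^ 'n"
    and Vn :: "'n \<Rightarrow> nat \<Rightarrow> 'a set"
    and V :: "'n \<Rightarrow> 'a set"
  assumes compact_UNIV: "compact (UNIV :: 'a set)"
    and cont: "continuous_on UNIV (f n)"
    and equi_cont: "equi_continuous dist (\<lambda>n. UNIV) dist f"
    and transition: "transition_matrix A"
    and closed_Vn: "closed (Vn i n)"
    and closed_V: "closed (V i)"
    and disjoint_V: "i \<noteq> j \<Longrightarrow> V i \<inter> V j = {}"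
    and Vn_subset: "Vn i n \<subseteq> V i"
    and itinerary_nonempty: "\<alpha> \<in> subshift A \<Longrightarrow> itinerary_set f Vn \<alpha> m n \<noteq> {}"
    and itinerary_shrinks: "\<alpha> \<in> subshift A \<Longrightarrow>
           uniform_limit UNIV (\<lambda>m n. diameter (itinerary_set f Vn \<alpha> m n)) (\<lambda>n. 0) sequentially"
begin

text \<open>Distances are bounded by \<open>diameter\<close> only in bounded sets.\<close>

lemma bounded_any: "bounded (S :: 'a set)"
  using compact_UNIV compact_imp_bounded bounded_subset by blast

lemma symbol_unique: "x \<in> Vn i n \<Longrightarrow> x \<in> Vn j n \<Longrightarrow> i = j"
  using Vn_subset disjoint_V by blast

lemma closed_iterates_vimage: "closed (iterates f n k -` Vn i m)"
  by (intro closed_vimage closed_Vn continuous_on_iterates cont)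

text \<open>The hypothesis is uniform in time but not in the sequence. Itinerary sets depend on a
  finite prefix only, so each sequence has a prefix length that works for all admissible sequences
  sharing the prefix; by the fan theorem finitely many prefixes suffice, and the largest length
  serves for all.\<close>

lemma same_itinerary_close:
  assumes "\<epsilon> > 0"
  shows "\<exists>K. \<forall>\<alpha>\<in>subshift A. \<forall>n. \<forall>x\<in>itinerary_set f Vn \<alpha> K n. \<forall>y\<in>itinerary_set f Vn \<alpha> K n.
    dist x y < \<epsilon>"
proof -
  have "\<exists>M. \<forall>\<beta>\<in>subshift A. (\<forall>i\<le>M. \<beta> i = \<alpha> i) \<longrightarrow>
      (\<forall>n. diameter (itinerary_set f Vn \<beta> M n) < \<epsilon>)" for \<alpha>
  proof (cases "\<alpha> \<in> subshift A")
    case True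
    have "\<forall>\<^sub>F m in sequentially. \<forall>n\<in>UNIV. dist (diameter (itinerary_set f Vn \<alpha> m n)) 0 < \<epsilon>"
      by (rule uniform_limitD[OF itinerary_shrinks[OF True] assms])
    then obtain M where M: "\<And>n. \<bar>diameter (itinerary_set f Vn \<alpha> M n)\<bar> < \<epsilon>"
      by (auto simp: eventually_sequentially)
    show ?thesis
    proof (intro exI[of _ M] ballI impI allI)
      fix \<beta> n assume "\<forall>i\<le>M. \<beta> i = \<alpha> i"
      then have "itinerary_set f Vn \<beta> M n = itinerary_set f Vn \<alpha> M n"
        by (auto simp: itinerary_set_iff)
      then show "diameter (itinerary_set f Vn \<beta> M n) < \<epsilon>" using M[of n] by (simp add: abs_less_iff)
    qed
  next
    case False
    \<comment> \<open>The fan theorem ranges over all sequences. An inadmissible one gets a prefix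
      long enough to show a forbidden transition, which no admissible sequence shares.\<close>
    then obtain j where j: "A $ \<alpha> j $ \<alpha> (Suc j) \<noteq> 1" by (auto simp: subshift_def)
    show ?thesis
    proof (intro exI[of _ "Suc j"] ballI impI)
      fix \<beta> assume "\<beta> \<in> subshift A" "\<forall>i\<le>Suc j. \<beta> i = \<alpha> i"
      then have "A $ \<alpha> j $ \<alpha> (Suc j) = 1" by (auto simp: subshift_def dest: spec[of _ j])
      with j show "\<forall>n. diameter (itinerary_set f Vn \<beta> (Suc j) n) < \<epsilon>" by simp
    qed
  qed
  then obtain K where K: "\<And>\<alpha> \<beta> n. \<beta> \<in> subshift A \<Longrightarrow> (\<forall>i\<le>K \<alpha>. \<beta> i = \<alpha> i) \<Longrightarrow>
      diameter (itinerary_set f Vn \<beta> (K \<alpha>) n) < \<epsilon>"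
    by metis
  obtain F where F: "finite F" "\<And>\<beta>. \<exists>\<alpha>\<in>F. \<forall>i\<le>K \<alpha>. \<beta> i = \<alpha> i"
    by (rule finite_cylinder_cover[of K]) blast
  have "dist x y < \<epsilon>"
    if "\<beta> \<in> subshift A" "x \<in> itinerary_set f Vn \<beta> (Max (K ` F)) n"
      "y \<in> itinerary_set f Vn \<beta> (Max (K ` F)) n" for \<beta> n x y
  proof -
    obtain \<alpha> where \<alpha>: "\<alpha> \<in> F" "\<forall>i\<le>K \<alpha>. \<beta> i = \<alpha> i" using F(2) by blast
    have "K \<alpha> \<le> Max (K ` F)" using F(1) \<alpha>(1) by simp
    then have "x \<in> itinerary_set f Vn \<beta> (K \<alpha>) n" "y \<in> itinerary_set f Vn \<beta> (K \<alpha>) n"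
      using that(2,3) by (auto simp: itinerary_set_iff)
    then have "dist x y \<le> diameter (itinerary_set f Vn \<beta> (K \<alpha>) n)"
      by (intro diameter_bounded_bound bounded_any)
    also have "\<dots> < \<epsilon>" by (rule K[OF that(1) \<alpha>(2)])
    finally show ?thesis .
  qed
  then show ?thesis by blast
qed

lemma itinerary_point_unique:
  assumes "\<alpha> \<in> subshift A" "\<And>k. iterates f n k x \<in> Vn (\<alpha> k) (n + k)"
    "\<And>k. iterates f n k y \<in> Vn (\<alpha> k) (n + k)"
  shows "x = y"
proof (rule ccontr)
  assume "x \<noteq> y"
  then have "dist x y > 0" by simp
  then obtain K where "\<forall>\<alpha>\<in>subshift A. \<forall>n. \<forall>u\<in>itinerary_set f Vn \<alpha> K n.
      \<forall>v\<in>itinerary_set f Vn \<alpha> K n. dist u v < dist x y"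
    using same_itinerary_close by blast
  moreover have "x \<in> itinerary_set f Vn \<alpha> K n" "y \<in> itinerary_set f Vn \<alpha> K n"
    using assms(2,3) by (simp_all add: itinerary_set_iff)
  ultimately show False using assms(1) by blast
qed

text \<open>Finite intersection property: a finite set of times lies below its supremum, so the
  corresponding intersection contains a nonempty itinerary set.\<close>

lemma itinerary_point_exists:
  assumes "\<alpha> \<in> subshift A"
  shows "\<exists>x. \<forall>k. iterates f n k x \<in> Vn (\<alpha> k) (n + k)"
proof -
  have "UNIV \<inter> (\<Inter>k. iterates f n k -` Vn (\<alpha> k) (n + k)) \<noteq> {}"
  proof (rule compact_imp_fip_image[OF compact_UNIV closed_iterates_vimage])
    fix I :: "nat set" assume "finite I"
    obtain x where "x \<in> itinerary_set f Vn \<alpha> (Sup I) n"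
      using itinerary_nonempty[OF assms] by blast
    moreover have "k \<le> Sup I" if "k \<in> I" for k
      using \<open>finite I\<close> that by (intro le_cSup_finite)
    ultimately have "x \<in> UNIV \<inter> (\<Inter>k\<in>I. iterates f n k -` Vn (\<alpha> k) (n + k))"
      by (simp add: itinerary_set_iff)
    then show "UNIV \<inter> (\<Inter>k\<in>I. iterates f n k -` Vn (\<alpha> k) (n + k)) \<noteq> {}" by blast
  qed
  then show ?thesis by auto
qed

text \<open>For admissible \<alpha> there is exactly one such point, so the choice is
  determined.\<close>

definition point :: "(nat \<Rightarrow> 'n) \<Rightarrow> nat \<Rightarrow> 'a" where
  "point \<alpha> n = (SOME x. \<forall>k. iterates f n k x \<in> Vn (\<alpha> k) (n + k))"

lemma iterates_point: "\<alpha> \<in> subshift A \<Longrightarrow> iterates f n k (point \<alpha> n) \<in> Vn (\<alpha> k) (n + k)"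
  unfolding point_def using someI_ex[OF itinerary_point_exists] by blast

lemma point_eqI:
  assumes "\<alpha> \<in> subshift A" "\<And>k. iterates f n k x \<in> Vn (\<alpha> k) (n + k)"
  shows "point \<alpha> n = x"
  using assms iterates_point by (intro itinerary_point_unique) auto

text \<open>The iterate follows the itinerary with its first \<open>k\<close> symbols dropped, and
  uniqueness identifies it.\<close>

lemma iterates_point_eq:
  assumes "\<alpha> \<in> subshift A"
  shows "iterates f n k (point \<alpha> n) = point (\<lambda>j. \<alpha> (k + j)) (n + k)"
proof (rule point_eqI[symmetric])
  show "(\<lambda>j. \<alpha> (k + j)) \<in> subshift A" using assms by (simp add: subshift_def)
  show "iterates f (n + k) l (iterates f n k (point \<alpha> n)) \<in> Vn (\<alpha> (k + l)) (n + k + l)" for l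
    unfolding iterates_add using iterates_point[OF assms, of n "k + l"] by (simp add: add.assoc)
qed

lemma map_point_eq: "\<alpha> \<in> subshift A \<Longrightarrow> f n (point \<alpha> n) = point (shift \<alpha>) (Suc n)"
  using iterates_point_eq[of \<alpha> n 1] by (simp add: shift_def)

definition points :: "nat \<Rightarrow> 'a set" where
  "points n = (\<lambda>\<alpha>. point \<alpha> n) ` subshift A"

text \<open>Admissibility is a condition on pairs of consecutive symbols. For each \<open>k\<close>
  it cuts out a finite union of closed sets, and \<open>points n\<close> is the intersection of
  these unions.\<close>

lemma compact_points: "compact (points n)"
proof -
  let ?S = "\<lambda>k. \<Union>(i, j)\<in>{(i, j). A $ i $ j = 1}.
    iterates f n k -` Vn i (n + k) \<inter> iterates f n (Suc k) -` Vn j (n + Suc k)"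
  have "points n = (\<Inter>k. ?S k)"
  proof
    show "points n \<subseteq> (\<Inter>k. ?S k)"
    proof
      fix x assume "x \<in> points n"
      then obtain \<alpha> where "\<alpha> \<in> subshift A" "x = point \<alpha> n" by (auto simp: points_def)
      then have "A $ \<alpha> k $ \<alpha> (Suc k) = 1 \<and> iterates f n k x \<in> Vn (\<alpha> k) (n + k) \<and>
          iterates f n (Suc k) x \<in> Vn (\<alpha> (Suc k)) (n + Suc k)" for k
        using iterates_point[of \<alpha> n k] iterates_point[of \<alpha> n "Suc k"] by (simp add: subshift_def)
      then show "x \<in> (\<Inter>k. ?S k)" by (intro INT_I UN_I[of "(\<alpha> _, \<alpha> (Suc _))"]) auto
    qed
    show "(\<Inter>k. ?S k) \<subseteq> points n"
    proof
      fix x assume "x \<in> (\<Inter>k. ?S k)"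
      then have "\<forall>k. \<exists>i j. A $ i $ j = 1 \<and> iterates f n k x \<in> Vn i (n + k) \<and>
          iterates f n (Suc k) x \<in> Vn j (n + Suc k)"
        by auto
      then obtain \<alpha> \<beta> where "\<And>k. A $ \<alpha> k $ \<beta> k = 1"
        and \<alpha>: "\<And>k. iterates f n k x \<in> Vn (\<alpha> k) (n + k)"
        and "\<And>k. iterates f n (Suc k) x \<in> Vn (\<beta> k) (n + Suc k)"
        by metis
      \<comment> \<open>Overlapping pairs fit together, since at each time a point has at most one
        symbol.\<close>
      moreover from this have "\<beta> k = \<alpha> (Suc k)" for k
        using symbol_unique by blast
      ultimately have "\<alpha> \<in> subshift A" by (simp add: subshift_def)
      with \<alpha> show "x \<in> points n" unfolding points_def using point_eqI by blast
    qed
  qed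
  moreover have "closed (\<Inter>k. ?S k)"
    by (intro closed_INT ballI closed_UN) (auto intro!: closed_Int closed_iterates_vimage simp del: iterates.simps)
  ultimately show ?thesis using compact_UNIV compact_Int_closed[of UNIV] by auto
qed

section \<open>Metric closeness versus common symbols\<close>

lemma same_symbols_imp_close:
  assumes "\<epsilon> > 0"
  obtains K where "\<And>n \<alpha> \<beta>. \<lbrakk>\<alpha> \<in> subshift A; \<beta> \<in> subshift A; \<And>k. k \<le> K \<Longrightarrow> \<alpha> k = \<beta> k\<rbrakk> \<Longrightarrow>
    dist (point \<alpha> n) (point \<beta> n) < \<epsilon>"
proof -
  obtain K where K: "\<And>\<alpha> n x y. \<alpha> \<in> subshift A \<Longrightarrow> x \<in> itinerary_set f Vn \<alpha> K n \<Longrightarrow>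
      y \<in> itinerary_set f Vn \<alpha> K n \<Longrightarrow> dist x y < \<epsilon>"
    using same_itinerary_close[OF assms] by blast
  show ?thesis
  proof (rule that, rule K)
    fix n \<alpha> \<beta> assume *: "\<alpha> \<in> subshift A" "\<beta> \<in> subshift A" "\<And>k. k \<le> K \<Longrightarrow> \<alpha> k = \<beta> k"
    show "\<alpha> \<in> subshift A" by fact
    show "point \<alpha> n \<in> itinerary_set f Vn \<alpha> K n"
      using iterates_point[OF *(1), of n] by (simp add: itinerary_set_iff)
    show "point \<beta> n \<in> itinerary_set f Vn \<alpha> K n"
      using iterates_point[OF *(2), of n] by (simp add: itinerary_set_iff *(3))
  qed
qed

text \<open>The bound is independent of time because the separated sets \<open>V i\<close> contain
  \<open>Vn i n\<close> for every \<open>n\<close>.\<close>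

lemma close_iterates_imp_same_symbol:
  obtains \<eta> where "\<eta> > 0" "\<And>n k \<alpha> \<beta>. \<lbrakk>\<alpha> \<in> subshift A; \<beta> \<in> subshift A;
    dist (iterates f n k (point \<alpha> n)) (iterates f n k (point \<beta> n)) < \<eta>\<rbrakk> \<Longrightarrow> \<alpha> k = \<beta> k"
proof -
  obtain \<eta> where "\<eta> > 0" and \<eta>: "\<And>x y i j. dist x y < \<eta> \<Longrightarrow> x \<in> V i \<Longrightarrow> y \<in> V j \<Longrightarrow> i = j"
    by (rule disjoint_closed_separation[OF compact_UNIV, of V]) (use closed_V disjoint_V in blast)+
  show ?thesis
    by (rule that[OF \<open>\<eta> > 0\<close>], rule \<eta>) (use iterates_point Vn_subset in blast)+
qed

text \<open>Equi-continuity of the iterates up to order \<open>K\<close> pulls the separation bound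
  back to the starting points, uniformly in \<open>n\<close>; the minimum over finitely many orders
  is positive.\<close>

lemma close_imp_same_symbols:
  obtains \<delta> where "\<delta> > 0" "\<And>n \<alpha> \<beta> k. \<lbrakk>\<alpha> \<in> subshift A; \<beta> \<in> subshift A;
    dist (point \<alpha> n) (point \<beta> n) < \<delta>; k \<le> K\<rbrakk> \<Longrightarrow> \<alpha> k = \<beta> k"
proof -
  obtain \<eta> where "\<eta> > 0" and \<eta>: "\<And>n k \<alpha> \<beta>. \<lbrakk>\<alpha> \<in> subshift A; \<beta> \<in> subshift A;
      dist (iterates f n k (point \<alpha> n)) (iterates f n k (point \<beta> n)) < \<eta>\<rbrakk> \<Longrightarrow> \<alpha> k = \<beta> k"
    by (rule close_iterates_imp_same_symbol) blast
  have "\<exists>\<delta>>0. \<forall>n x y. dist x y < \<delta> \<longrightarrow> dist (iterates f n k x) (iterates f n k y) < \<eta>" for k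
    using equi_continuous_iterates[OF equi_cont, of k] \<open>\<eta> > 0\<close> by (simp add: equi_continuous_def)
  then obtain d where d: "\<And>k. d k > 0"
    "\<And>k n x y. dist x y < d k \<Longrightarrow> dist (iterates f n k x) (iterates f n k y) < \<eta>"
    by metis
  show ?thesis
  proof (rule that)
    show "Min (d ` {..K}) > 0" using d(1) by (subst Min_gr_iff) auto
    show "\<alpha> k = \<beta> k" if "\<alpha> \<in> subshift A" "\<beta> \<in> subshift A"
      "dist (point \<alpha> n) (point \<beta> n) < Min (d ` {..K})" "k \<le> K" for n \<alpha> \<beta> k
      using that by (intro \<eta>[of _ _ n] d(2)) auto
  qed
qed

lemma point_eq_iff:
  assumes "\<alpha> \<in> subshift A" "\<beta> \<in> subshift A"
  shows "point \<alpha> n = point \<beta> n \<longleftrightarrow> \<alpha> = \<beta>"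
proof
  assume "point \<alpha> n = point \<beta> n"
  then show "\<alpha> = \<beta>" using assms iterates_point symbol_unique by (metis ext)
qed simp

subsection \<open>The conjugacy\<close>

definition family :: "nat \<Rightarrow> 'a set set" where
  "family n = (\<lambda>x. {x}) ` points n"

lemma family_eq: "family n = (\<lambda>\<alpha>. {point \<alpha> n}) ` subshift A"
  by (auto simp: family_def points_def)

lemma family_nonempty: "family n \<noteq> {}"
  using subshift_nonempty[OF transition] by (simp add: family_eq)

lemma family_compactin: "compactin hausdorff_topology (family n)"
  unfolding family_def by (rule compactin_singletons[OF compact_points])

lemma family_subset: "family n \<subseteq> (\<Union>i. compacts_within (Vn i n))"
  using iterates_point[of _ n 0] by (fastforce simp: family_eq compacts_within_def)

lemma induced_family: "induced f n ` family n = family (Suc n)"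
proof -
  have "induced f n ` family n = (\<lambda>\<alpha>. {point (shift \<alpha>) (Suc n)}) ` subshift A"
    unfolding family_eq image_image by (intro image_cong) (simp_all add: induced_def map_point_eq)
  also have "\<dots> = (\<lambda>\<alpha>. {point \<alpha> (Suc n)}) ` shift ` subshift A"
    by (simp add: image_image)
  also have "\<dots> = family (Suc n)"
    unfolding shift_image_subshift[OF transition] family_eq ..
  finally show ?thesis .
qed

lemma family_equi_conjugate:
  "topologically_equi_conjugate hausdorff_dist family (induced f) symbol_dist (subshift A) shift"
proof -
  define g where "g n \<alpha> = {point \<alpha> n}" for n \<alpha>
  \<comment> \<open>The explicit map is the decoding \<open>g\<close>; the conjugacy is its inverse,
    which reads off the itinerary.\<close>
  define h where "h n = inv_into (subshift A) (g n)" for n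
  have bij: "bij_betw (g n) (subshift A) (family n)" for n
    by (auto simp: bij_betw_def inj_on_def g_def family_eq point_eq_iff)
  have h_g: "h n (g n \<alpha>) = \<alpha>" if "\<alpha> \<in> subshift A" for n \<alpha>
    unfolding h_def using bij that by (simp add: bij_betw_def)
  have "bij_betw (h n) (family n) (subshift A)" for n
    unfolding h_def by (rule bij_betw_inv_into[OF bij])
  moreover have "h (Suc n) (induced f n B) = shift (h n B)" if "B \<in> family n" for n B
  proof -
    obtain \<alpha> where \<alpha>: "\<alpha> \<in> subshift A" "B = g n \<alpha>" using \<open>B \<in> family n\<close> by (auto simp: family_eq g_def)
    have "induced f n B = g (Suc n) (shift \<alpha>)"
      using \<alpha> by (simp add: g_def induced_def map_point_eq)
    then show ?thesis using \<alpha> h_g shift_in_subshift by metis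
  qed
  moreover have "equi_continuous hausdorff_dist family symbol_dist h"
    unfolding equi_continuous_def
  proof (intro allI impI)
    fix \<epsilon> :: real assume "\<epsilon> > 0"
    then obtain K where "(1/2) ^ K < \<epsilon>" using real_arch_pow_inv[of \<epsilon> "1/2"] by auto
    \<comment> \<open>Agreement at the indices \<open>0\<close> to \<open>K\<close> means
      \<open>Suc K\<close> common letters, which gives this bound for
      \<open>symbol_dist\<close>.\<close>
    then have K: "2 / 2 ^ Suc K < \<epsilon>" by (simp add: power_one_over)
    obtain \<delta> where "\<delta> > 0" and \<delta>: "\<And>n \<alpha> \<beta> k. \<lbrakk>\<alpha> \<in> subshift A; \<beta> \<in> subshift A;
        dist (point \<alpha> n) (point \<beta> n) < \<delta>; k \<le> K\<rbrakk> \<Longrightarrow> \<alpha> k = \<beta> k"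
      by (rule close_imp_same_symbols[of K]) blast
    have "symbol_dist (h n B) (h n C) < \<epsilon>"
      if "B \<in> family n" "C \<in> family n" "hausdorff_dist B C < \<delta>" for n B C
    proof -
      obtain \<alpha> \<beta> where \<alpha>\<beta>: "\<alpha> \<in> subshift A" "B = g n \<alpha>" "\<beta> \<in> subshift A" "C = g n \<beta>"
        using \<open>B \<in> family n\<close> \<open>C \<in> family n\<close> by (auto simp: family_eq g_def)
      then have "symbol_dist \<alpha> \<beta> \<le> 2 / 2 ^ Suc K"
        using that(3) by (intro symbol_dist_le \<delta>[of \<alpha> \<beta> n]) (auto simp: g_def)
      then show ?thesis using \<alpha>\<beta> h_g K by simp
    qed
    then show "\<exists>\<delta>>0. \<forall>n. \<forall>B\<in>family n. \<forall>C\<in>family n.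
        hausdorff_dist B C < \<delta> \<longrightarrow> symbol_dist (h n B) (h n C) < \<epsilon>"
      using \<open>\<delta> > 0\<close> by blast
  qed
  moreover have "equi_continuous symbol_dist (\<lambda>n. subshift A) hausdorff_dist
      (\<lambda>n. inv_into (family n) (h n))"
    unfolding equi_continuous_def
  proof (intro allI impI)
    fix \<epsilon> :: real assume "\<epsilon> > 0"
    then obtain K where K: "\<And>n \<alpha> \<beta>. \<lbrakk>\<alpha> \<in> subshift A; \<beta> \<in> subshift A;
        \<And>k. k \<le> K \<Longrightarrow> \<alpha> k = \<beta> k\<rbrakk> \<Longrightarrow> dist (point \<alpha> n) (point \<beta> n) < \<epsilon>"
      by (rule same_symbols_imp_close) blast
    have inv_h: "inv_into (family n) (h n) \<alpha> = g n \<alpha>" if "\<alpha> \<in> subshift A" for n \<alpha>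
      unfolding h_def by (rule inv_into_inv_into_eq[OF bij that])
    have "hausdorff_dist (inv_into (family n) (h n) \<alpha>) (inv_into (family n) (h n) \<beta>) < \<epsilon>"
      if "\<alpha> \<in> subshift A" "\<beta> \<in> subshift A" "symbol_dist \<alpha> \<beta> < 1 / 2 ^ K" for n \<alpha> \<beta>
      using K[OF that(1,2) symbol_dist_less_imp_eq[OF that(3)], of n] inv_h that(1,2)
      by (simp add: g_def)
    then show "\<exists>\<delta>>0. \<forall>n. \<forall>\<alpha>\<in>subshift A. \<forall>\<beta>\<in>subshift A. symbol_dist \<alpha> \<beta> < \<delta> \<longrightarrow>
        hausdorff_dist (inv_into (family n) (h n) \<alpha>) (inv_into (family n) (h n) \<beta>) < \<epsilon>"
      by (intro exI[of _ "1 / 2 ^ K"]) simp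
  qed
  ultimately show ?thesis
    unfolding topologically_equi_conjugate_def using induced_family by auto
qed

subsection \<open>Entropy\<close>

text \<open>The \<open>j\<close>-th iterate is the point of the \<open>j\<close>-fold shifted
  sequence, so agreement in a window that starts at \<open>j\<close> is enough.\<close>

lemma same_symbols_imp_close_iterates:
  assumes "\<epsilon> > 0"
  obtains K where "\<And>n j \<alpha> \<beta>. \<lbrakk>\<alpha> \<in> subshift A; \<beta> \<in> subshift A;
      \<And>k. j \<le> k \<Longrightarrow> k \<le> j + K \<Longrightarrow> \<alpha> k = \<beta> k\<rbrakk> \<Longrightarrow>
    dist (iterates f n j (point \<alpha> n)) (iterates f n j (point \<beta> n)) < \<epsilon>"
proof -
  obtain K where K: "\<And>n \<alpha> \<beta>. \<lbrakk>\<alpha> \<in> subshift A; \<beta> \<in> subshift A; \<And>k. k \<le> K \<Longrightarrow> \<alpha> k = \<beta> k\<rbrakk> \<Longrightarrow>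
      dist (point \<alpha> n) (point \<beta> n) < \<epsilon>"
    by (rule same_symbols_imp_close[OF assms]) blast
  show ?thesis
  proof (rule that)
    fix n j \<alpha> \<beta> assume *: "\<alpha> \<in> subshift A" "\<beta> \<in> subshift A"
      "\<And>k. j \<le> k \<Longrightarrow> k \<le> j + K \<Longrightarrow> \<alpha> k = \<beta> k"
    show "dist (iterates f n j (point \<alpha> n)) (iterates f n j (point \<beta> n)) < \<epsilon>"
      unfolding iterates_point_eq[OF *(1)] iterates_point_eq[OF *(2)]
      by (rule K) (use * in \<open>simp_all add: subshift_def\<close>)
  qed
qed

lemma close_iterates_imp_same_symbols:
  obtains \<delta> where "\<delta> > 0" "\<And>n j k \<alpha> \<beta>. \<lbrakk>\<alpha> \<in> subshift A; \<beta> \<in> subshift A;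
    dist (iterates f n j (point \<alpha> n)) (iterates f n j (point \<beta> n)) < \<delta>; k \<le> K\<rbrakk> \<Longrightarrow>
    \<alpha> (j + k) = \<beta> (j + k)"
proof -
  obtain \<delta> where "\<delta> > 0" and \<delta>: "\<And>n \<alpha> \<beta> k. \<lbrakk>\<alpha> \<in> subshift A; \<beta> \<in> subshift A;
      dist (point \<alpha> n) (point \<beta> n) < \<delta>; k \<le> K\<rbrakk> \<Longrightarrow> \<alpha> k = \<beta> k"
    by (rule close_imp_same_symbols[of K]) blast
  show ?thesis
  proof (rule that[OF \<open>\<delta> > 0\<close>])
    fix n j k \<alpha> \<beta> assume *: "\<alpha> \<in> subshift A" "\<beta> \<in> subshift A"
      "dist (iterates f n j (point \<alpha> n)) (iterates f n j (point \<beta> n)) < \<delta>" "k \<le> K"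
    have "(\<lambda>i. \<alpha> (j + i)) \<in> subshift A" "(\<lambda>i. \<beta> (j + i)) \<in> subshift A"
      using *(1,2) by (simp_all add: subshift_def)
    from \<delta>[OF this *(3)[unfolded iterates_point_eq[OF *(1)] iterates_point_eq[OF *(2)]] *(4)]
    show "\<alpha> (j + k) = \<beta> (j + k)" .
  qed
qed

section \<open>Subcovers counted by admissible words\<close>

definition word_extension :: "nat \<Rightarrow> 'n list \<Rightarrow> nat \<Rightarrow> 'n" where
  "word_extension n w = (SOME \<alpha>. \<alpha> \<in> subshift A \<and> map \<alpha> [0..<Suc n] = w)"

lemma word_extension:
  assumes "w \<in> paths A n"
  shows "word_extension n w \<in> subshift A" "map (word_extension n w) [0..<Suc n] = w"
proof -
  have "\<exists>\<alpha>. \<alpha> \<in> subshift A \<and> map \<alpha> [0..<Suc n] = w"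
    using assms unfolding prefixes_subshift[OF transition, symmetric] by blast
  from someI_ex[OF this]
  show "word_extension n w \<in> subshift A" "map (word_extension n w) [0..<Suc n] = w"
    unfolding word_extension_def by blast+
qed

definition restricted_cover :: "'a set set set \<Rightarrow> nat \<Rightarrow> 'a set set set" where
  "restricted_cover \<A> n =
    (\<lambda>B. B \<inter> family 0) ` joined_cover hausdorff_topology (induced f) \<A> n"

lemma restricted_cover_iff:
  "B \<in> restricted_cover \<A> n \<longleftrightarrow>
    (\<exists>U. (\<forall>j<n. U j \<in> \<A>) \<and>
      B = {{point \<alpha> 0} | \<alpha>. \<alpha> \<in> subshift A \<and> (\<forall>j<n. {iterates f 0 j (point \<alpha> 0)} \<in> U j)})"
proof -
  have top: "topspace (hausdorff_topology :: 'a set topology) = nonempty_compacts"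
    by (rule Metric_space.topspace_mtopology[OF Metric_space_hausdorff])
  have eq: "topspace hausdorff_topology \<inter> (\<Inter>j<n. iterates (induced f) 0 j -` U j) \<inter> family 0 =
      {{point \<alpha> 0} | \<alpha>. \<alpha> \<in> subshift A \<and> (\<forall>j<n. {iterates f 0 j (point \<alpha> 0)} \<in> U j)}" for U
    unfolding top by (auto simp: family_eq iterates_induced_singleton)
  have "B \<in> restricted_cover \<A> n \<longleftrightarrow> (\<exists>U. (\<forall>j<n. U j \<in> \<A>) \<and>
      B = topspace hausdorff_topology \<inter> (\<Inter>j<n. iterates (induced f) 0 j -` U j) \<inter> family 0)"
    unfolding restricted_cover_def joined_cover_def by blast
  then show ?thesis unfolding eq .
qed

text \<open>Agreement on \<open>K + 1\<close> letters from time \<open>j\<close> on keeps the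
  \<open>j\<close>-th iterates within a Lebesgue number of the cover. A word with
  \<open>n + K\<close> edges thus fixes a cover element for every time before \<open>n\<close>, and
  one member per word suffices.\<close>

lemma finite_restricted_subcover:
  assumes "\<A> \<in> open_covers hausdorff_topology"
  shows "\<exists>K. \<forall>n. \<exists>\<D>\<subseteq>restricted_cover \<A> n.
    finite \<D> \<and> \<Union>\<D> = family 0 \<and> card \<D> \<le> card (paths A (n + K))"
proof -
  let ?\<U> = "(\<lambda>U. (\<lambda>x. {x}) -` U) ` \<A>"
  have top: "topspace (hausdorff_topology :: 'a set topology) = nonempty_compacts"
    by (rule Metric_space.topspace_mtopology[OF Metric_space_hausdorff])
  have op: "open U" if "U \<in> ?\<U>" for U
    using that assms open_singleton_vimage by (auto simp: open_covers_def)
  have cover: "UNIV \<subseteq> \<Union>?\<U>"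
  proof
    fix x :: 'a
    have "{x} \<in> \<Union>\<A>" using assms by (simp add: open_covers_def top)
    then show "x \<in> \<Union>?\<U>" by auto
  qed
  obtain \<epsilon> where "\<epsilon> > 0" and \<epsilon>: "\<And>x. x \<in> UNIV \<Longrightarrow> \<exists>U\<in>?\<U>. ball x \<epsilon> \<subseteq> U"
    using Heine_Borel_lemma[OF compact_UNIV cover op] by blast
  have "\<exists>U\<in>\<A>. \<forall>y. dist x y < \<epsilon> \<longrightarrow> {y} \<in> U" for x
    using \<epsilon>[of x] by (auto simp: subset_iff)
  then obtain T where T: "\<And>x. T x \<in> \<A>" "\<And>x y. dist x y < \<epsilon> \<Longrightarrow> {y} \<in> T x"
    by metis
  obtain K where K: "\<And>n j \<alpha> \<beta>. \<lbrakk>\<alpha> \<in> subshift A; \<beta> \<in> subshift A;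
      \<And>k. j \<le> k \<Longrightarrow> k \<le> j + K \<Longrightarrow> \<alpha> k = \<beta> k\<rbrakk> \<Longrightarrow>
    dist (iterates f n j (point \<alpha> n)) (iterates f n j (point \<beta> n)) < \<epsilon>"
    by (rule same_symbols_imp_close_iterates[OF \<open>\<epsilon> > 0\<close>]) blast
  show ?thesis
  proof (rule exI, rule allI)
    fix n
    \<comment> \<open>The cover elements for \<open>w\<close> follow the orbit of one
      representative; \<open>T x\<close> contains the singletons of the \<epsilon>-ball around
      \<open>x\<close>.\<close>
    let ?U = "\<lambda>w j. T (iterates f 0 j (point (word_extension (n + K) w) 0))"
    let ?B = "\<lambda>w. {{point \<alpha> 0} | \<alpha>. \<alpha> \<in> subshift A \<and> (\<forall>j<n. {iterates f 0 j (point \<alpha> 0)} \<in> ?U w j)}"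
    let ?\<D> = "?B ` paths A (n + K)"
    have "?\<D> \<subseteq> restricted_cover \<A> n"
    proof
      fix B assume "B \<in> ?\<D>"
      then obtain w where "B = ?B w" by blast
      then show "B \<in> restricted_cover \<A> n"
        unfolding restricted_cover_iff using T(1) by (intro exI[of _ "?U w"]) blast
    qed
    moreover have "finite ?\<D>" "card ?\<D> \<le> card (paths A (n + K))"
      by (simp_all add: finite_paths card_image_le)
    moreover have "\<Union>?\<D> = family 0"
    proof
      show "\<Union>?\<D> \<subseteq> family 0" by (auto simp: family_eq)
      show "family 0 \<subseteq> \<Union>?\<D>"
      proof
        fix B assume "B \<in> family 0"
        then obtain \<alpha> where \<alpha>: "\<alpha> \<in> subshift A" "B = {point \<alpha> 0}" by (auto simp: family_eq)
        define w where "w = map \<alpha> [0..<Suc (n + K)]"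
        have w: "w \<in> paths A (n + K)"
          using \<alpha>(1) prefixes_subshift[OF transition] unfolding w_def by blast
        have "{iterates f 0 j (point \<alpha> 0)} \<in> ?U w j" if "j < n" for j
        proof (rule T(2), rule K)
          fix k assume "k \<le> j + K"
          then have "w ! k = \<alpha> k" "map (word_extension (n + K) w) [0..<Suc (n + K)] ! k = word_extension (n + K) w k"
            using \<open>j < n\<close> by (simp_all add: w_def del: upt_Suc)
          then show "word_extension (n + K) w k = \<alpha> k" using word_extension(2)[OF w] by simp
        qed (use \<alpha> word_extension[OF w] in auto)
        then have "B \<in> ?B w" using \<alpha> by blast
        then show "B \<in> \<Union>?\<D>" using w by blast
      qed
    qed
    ultimately show "\<exists>\<D>\<subseteq>restricted_cover \<A> n. finite \<D> \<and> \<Union>\<D> = family 0 \<and>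
        card \<D> \<le> card (paths A (n + K))"
      by blast
  qed
qed

text \<open>Singletons in a common ball of radius \<open>\<eta> / 2\<close> have distance below
  \<eta>, hence the same symbol. The \<open>Suc n\<close> factors of the joined cover fix the times
  \<open>0\<close> to \<open>n\<close>, that is, all letters of a word in \<open>paths A n\<close>,
  so different words need different members.\<close>

lemma separating_cover:
  obtains \<A> where "\<A> \<in> open_covers hausdorff_topology"
    "\<And>n \<D>. \<lbrakk>\<D> \<subseteq> restricted_cover \<A> (Suc n); finite \<D>; \<Union>\<D> = family 0\<rbrakk> \<Longrightarrow>
      card (paths A n) \<le> card \<D>"
proof -
  interpret H: Metric_space nonempty_compacts "hausdorff_dist :: 'a set \<Rightarrow> _"
    by (rule Metric_space_hausdorff)
  obtain \<eta> where "\<eta> > 0" and \<eta>: "\<And>n k \<alpha> \<beta>. \<lbrakk>\<alpha> \<in> subshift A; \<beta> \<in> subshift A;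
      dist (iterates f n k (point \<alpha> n)) (iterates f n k (point \<beta> n)) < \<eta>\<rbrakk> \<Longrightarrow> \<alpha> k = \<beta> k"
    by (rule close_iterates_imp_same_symbol) blast
  let ?\<A> = "(\<lambda>B. H.mball B (\<eta> / 2)) ` nonempty_compacts"
  have small: "dist x y < \<eta>" if U: "U \<in> ?\<A>" "{x} \<in> U" "{y} \<in> U" for U x y
  proof -
    obtain B where B: "B \<in> nonempty_compacts" "hausdorff_dist B {x} < \<eta> / 2" "hausdorff_dist B {y} < \<eta> / 2"
      using U by auto
    then show ?thesis
      using H.triangle[of "{x}" B "{y}"] H.commute[of B "{x}"] by simp
  qed
  show ?thesis
  proof (rule that)
    show "?\<A> \<in> open_covers hausdorff_topology"
      using \<open>\<eta> > 0\<close> by (auto simp: open_covers_def)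
    fix n \<D> assume \<D>: "\<D> \<subseteq> restricted_cover ?\<A> (Suc n)" "finite \<D>" "\<Union>\<D> = family 0"
    have "\<exists>B\<in>\<D>. {point (word_extension n w) 0} \<in> B" if "w \<in> paths A n" for w
    proof -
      have "{point (word_extension n w) 0} \<in> family 0"
        using word_extension(1)[OF that] by (auto simp: family_eq)
      then show ?thesis using \<D>(3) by blast
    qed
    then obtain b where b: "\<And>w. w \<in> paths A n \<Longrightarrow> b w \<in> \<D>"
      "\<And>w. w \<in> paths A n \<Longrightarrow> {point (word_extension n w) 0} \<in> b w"
      by metis
    have "inj_on b (paths A n)"
    proof (rule inj_onI)
      fix v w assume v: "v \<in> paths A n" and w: "w \<in> paths A n" and eq: "b v = b w"
      have "b w \<in> restricted_cover ?\<A> (Suc n)" using b(1)[OF w] \<D>(1) by blast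
      then obtain U where U: "\<forall>j<Suc n. U j \<in> ?\<A>"
        and bw: "b w = {{point \<alpha> 0} | \<alpha>. \<alpha> \<in> subshift A \<and> (\<forall>j<Suc n. {iterates f 0 j (point \<alpha> 0)} \<in> U j)}"
        unfolding restricted_cover_iff by blast
      have in_U: "{iterates f 0 j (point (word_extension n u) 0)} \<in> U j"
        if "u \<in> paths A n" "b u = b w" "j < Suc n" for u j
        using b(2)[OF that(1)] that(3) unfolding that(2) bw by auto
      have "word_extension n v j = word_extension n w j" if "j < Suc n" for j
      proof (rule \<eta>)
        show "dist (iterates f 0 j (point (word_extension n v) 0)) (iterates f 0 j (point (word_extension n w) 0)) < \<eta>"
          using U in_U[OF v eq that] in_U[OF w refl that] that by (intro small[of "U j"]) auto
      qed (use word_extension(1) v w in auto)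
      then have "map (word_extension n v) [0..<Suc n] = map (word_extension n w) [0..<Suc n]" by simp
      then show "v = w" using word_extension(2)[OF v] word_extension(2)[OF w] by metis
    qed
    then show "card (paths A n) \<le> card \<D>"
      using b(1) \<D>(2) by (intro card_inj_on_le) auto
  qed
qed

lemma ln_card_paths_tendsto:
  "(\<lambda>n. 1 / real n * ln (real (card (paths A (n + K))))) \<longlonglongrightarrow> ln (matrix_rho A)"
  "(\<lambda>n. 1 / real (Suc n) * ln (real (card (paths A n)))) \<longlonglongrightarrow> ln (matrix_rho A)"
proof -
  define a where "a n = ln (real (card (paths A n)))" for n
  have a: "(\<lambda>n. a n / real n) \<longlonglongrightarrow> ln (matrix_rho A)"
    unfolding a_def card_paths[OF transition_matrix_entry[OF transition]]
    by (rule growth_rate_tendsto_ln_matrix_rho[OF transition])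
  have "(\<lambda>n. 1 + real K / real n) \<longlonglongrightarrow> 1 + 0"
    by (intro tendsto_intros lim_const_over_n)
  then have "(\<lambda>n. real (n + K) / real n) \<longlonglongrightarrow> 1 + 0"
    by (rule Lim_transform_eventually)
       (use eventually_gt_at_top[of 0] in eventually_elim, simp add: field_simps)
  from tendsto_mult[OF this LIMSEQ_ignore_initial_segment[OF a, of K]]
  have "(\<lambda>n. real (n + K) / real n * (a (n + K) / real (n + K))) \<longlonglongrightarrow> ln (matrix_rho A)" by simp
  then show "(\<lambda>n. 1 / real n * ln (real (card (paths A (n + K))))) \<longlonglongrightarrow> ln (matrix_rho A)"
    by (rule Lim_transform_eventually)
       (use eventually_gt_at_top[of 0] in eventually_elim, simp add: a_def)
  have "(\<lambda>n. real n / real (Suc n)) \<longlonglongrightarrow> 1" by (rule LIMSEQ_n_over_Suc_n)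
  from tendsto_mult[OF this a]
  have "(\<lambda>n. real n / real (Suc n) * (a n / real n)) \<longlonglongrightarrow> ln (matrix_rho A)" by simp
  then show "(\<lambda>n. 1 / real (Suc n) * ln (real (card (paths A n)))) \<longlonglongrightarrow> ln (matrix_rho A)"
    by (rule Lim_transform_eventually)
       (use eventually_gt_at_top[of 0] in eventually_elim, simp add: a_def)
qed

lemma family_entropy:
  "topological_entropy hausdorff_topology (induced f) (family 0) = ereal (ln (matrix_rho A))"
proof (rule antisym)
  let ?N = "\<lambda>\<A> n. min_subcover_card (restricted_cover \<A> n) (family 0)"
  show "topological_entropy hausdorff_topology (induced f) (family 0) \<le> ereal (ln (matrix_rho A))"
    unfolding topological_entropy_def restricted_cover_def[symmetric]
  proof (rule SUP_least)
    fix \<A> :: "'a set set set" assume "\<A> \<in> open_covers hausdorff_topology"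
    from finite_restricted_subcover[OF this]
    obtain K where K: "\<forall>n. \<exists>\<D>\<subseteq>restricted_cover \<A> n. finite \<D> \<and> \<Union>\<D> = family 0 \<and>
        card \<D> \<le> card (paths A (n + K))" ..
    have "ln (real (?N \<A> n)) \<le> ln (real (card (paths A (n + K))))" for n
    proof -
      from spec[OF K, of n]
      obtain \<D> where \<D>: "\<D> \<subseteq> restricted_cover \<A> n" "finite \<D>" "\<Union>\<D> = family 0"
        and card_le: "card \<D> \<le> card (paths A (n + K))"
        by (elim exE conjE)
      have "?N \<A> n \<le> card (paths A (n + K))"
        by (rule order.trans[OF min_subcover_card_le[OF \<D>] card_le])
      moreover have "card (paths A (n + K)) \<ge> 1"
        using entry_sum_matrix_pow_pos[OF transition, of "n + K"]
        by (simp add: card_paths[OF transition_matrix_entry[OF transition]])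
      \<comment> \<open>Monotonicity of \<open>ln\<close> needs a positive argument, so the count 0
        is treated separately.\<close>
      ultimately show ?thesis by (cases "?N \<A> n = 0") auto
    qed
    then have "limsup (\<lambda>n. ereal (1 / real n * ln (real (?N \<A> n)))) \<le>
        limsup (\<lambda>n. ereal (1 / real n * ln (real (card (paths A (n + K))))))"
      by (intro Limsup_mono always_eventually allI) (simp add: divide_right_mono)
    also have "\<dots> = ereal (ln (matrix_rho A))"
      by (rule lim_imp_Limsup) (use ln_card_paths_tendsto(1) in auto)
    finally show "limsup (\<lambda>n. ereal (1 / real n * ln (real (?N \<A> n)))) \<le> ereal (ln (matrix_rho A))" .
  qed
  obtain \<A> where \<A>: "\<A> \<in> open_covers hausdorff_topology"
    "\<And>n \<D>. \<lbrakk>\<D> \<subseteq> restricted_cover \<A> (Suc n); finite \<D>; \<Union>\<D> = family 0\<rbrakk> \<Longrightarrow>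
      card (paths A n) \<le> card \<D>"
    by (rule separating_cover) blast
  have "ln (real (card (paths A n))) \<le> ln (real (?N \<A> (Suc n)))" for n
  proof -
    have "\<exists>\<D>\<subseteq>restricted_cover \<A> (Suc n). finite \<D> \<and> \<Union>\<D> = family 0"
      using finite_restricted_subcover[OF \<A>(1)] by meson
    then have "card (paths A n) \<le> ?N \<A> (Suc n)"
      by (rule min_subcover_card_ge) (rule \<A>(2))
    moreover have "card (paths A n) \<ge> 1"
      using entry_sum_matrix_pow_pos[OF transition, of n]
      by (simp add: card_paths[OF transition_matrix_entry[OF transition]])
    ultimately show ?thesis by simp
  qed
  then have le: "1 / real (Suc n) * ln (real (card (paths A n))) \<le>
      1 / real (Suc n) * ln (real (?N \<A> (Suc n)))" for n
    by (intro mult_left_mono) auto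
  \<comment> \<open>The separating cover at \<open>n\<close> is compared with words of
    \<open>n - 1\<close> edges; the index is shifted to match the sequence in the definition of
    entropy.\<close>
  have "(\<lambda>n. 1 / real n * ln (real (card (paths A (n - 1))))) \<longlonglongrightarrow> ln (matrix_rho A)"
    by (subst filterlim_sequentially_Suc[symmetric]) (use ln_card_paths_tendsto(2) in simp)
  then have "ereal (ln (matrix_rho A)) =
      limsup (\<lambda>n. ereal (1 / real n * ln (real (card (paths A (n - 1))))))"
    by (intro lim_imp_Limsup[symmetric]) auto
  also have "\<dots> \<le> limsup (\<lambda>n. ereal (1 / real n * ln (real (?N \<A> n))))"
  proof (rule Limsup_mono)
    show "\<forall>\<^sub>F n in sequentially. ereal (1 / real n * ln (real (card (paths A (n - 1))))) \<le>
        ereal (1 / real n * ln (real (?N \<A> n)))"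
      using eventually_gt_at_top[of 0]
    proof eventually_elim
      case (elim n)
      then show ?case using le[of "n - 1"] by simp
    qed
  qed
  also have "\<dots> \<le> topological_entropy hausdorff_topology (induced f) (family 0)"
    unfolding topological_entropy_def restricted_cover_def[symmetric] using \<A>(1) by (rule SUP_upper)
  finally show "ereal (ln (matrix_rho A)) \<le>
      topological_entropy hausdorff_topology (induced f) (family 0)" .
qed

subsection \<open>Chaos\<close>

text \<open>Symbolic agreement and disagreement on blocks become metric statements, with one
  \<delta> for all pairs. The lost margin \<open>K\<close> absorbs the windows needed to compare
  symbols with distances.\<close>

lemma scrambled_set:
  assumes "irreducible_matrix A" "(\<Sum>j\<in>UNIV. A $ i $ j) \<ge> 2"
  obtains S L \<delta> where "S \<subseteq> (\<lambda>x. {x}) ` UNIV" "uncountable S" "L > 0" "\<delta> > 0"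
    "\<And>x y \<epsilon>. \<lbrakk>{x} \<in> S; {y} \<in> S; x \<noteq> y; \<epsilon> > 0\<rbrakk> \<Longrightarrow>
      \<exists>K. \<exists>\<^sub>\<infinity>m. \<forall>k. L * fact m \<le> k \<longrightarrow> k + K < L * fact (Suc m) \<longrightarrow>
        dist (iterates f 0 k x) (iterates f 0 k y) < \<epsilon>"
    "\<And>x y. \<lbrakk>{x} \<in> S; {y} \<in> S; x \<noteq> y\<rbrakk> \<Longrightarrow>
      \<exists>K. \<exists>\<^sub>\<infinity>m. \<forall>k. L * fact m \<le> k \<longrightarrow> k + K < L * fact (Suc m) \<longrightarrow>
        \<not> dist (iterates f 0 k x) (iterates f 0 k y) < \<delta>"
proof -
  obtain L D where LD: "L > 0" "D \<subseteq> subshift A" "uncountable D"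
    and same: "\<And>\<alpha> \<beta>. \<lbrakk>\<alpha> \<in> D; \<beta> \<in> D; \<alpha> \<noteq> \<beta>\<rbrakk> \<Longrightarrow>
      \<exists>\<^sub>\<infinity>m. \<forall>k. L * fact m \<le> k \<longrightarrow> k < L * fact (Suc m) \<longrightarrow> \<alpha> k = \<beta> k"
    and different: "\<And>\<alpha> \<beta>. \<lbrakk>\<alpha> \<in> D; \<beta> \<in> D; \<alpha> \<noteq> \<beta>\<rbrakk> \<Longrightarrow>
      \<exists>\<^sub>\<infinity>m. \<forall>k. L * fact m \<le> k \<longrightarrow> k + 2 * L < L * fact (Suc m) \<longrightarrow>
        (\<exists>l\<le>2 * L. \<alpha> (k + l) \<noteq> \<beta> (k + l))"
    by (rule scrambled_symbol_sequences[OF transition assms]) blast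
  obtain \<delta> where "\<delta> > 0" and \<delta>: "\<And>n j k \<alpha> \<beta>. \<lbrakk>\<alpha> \<in> subshift A; \<beta> \<in> subshift A;
      dist (iterates f n j (point \<alpha> n)) (iterates f n j (point \<beta> n)) < \<delta>; k \<le> 2 * L\<rbrakk> \<Longrightarrow>
      \<alpha> (j + k) = \<beta> (j + k)"
    \<comment> \<open>The window \<open>2 * L\<close> is the one in which \<open>different\<close>
      guarantees a differing letter.\<close>
    by (rule close_iterates_imp_same_symbols[of "2 * L"]) blast
  let ?S = "(\<lambda>\<alpha>. {point \<alpha> 0}) ` D"
  have "inj_on (\<lambda>\<alpha>. {point \<alpha> 0}) D"
    by (rule inj_onI) (metis LD(2) point_eq_iff singleton_inject subsetD)
  then have "uncountable ?S" using LD(3) countable_image_inj_eq by blast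
  show ?thesis
  proof (rule that[OF _ \<open>uncountable ?S\<close> LD(1) \<open>\<delta> > 0\<close>])
    fix x y \<epsilon> assume "{x} \<in> ?S" "{y} \<in> ?S" "x \<noteq> y" "(\<epsilon> :: real) > 0"
    then obtain \<alpha> \<beta> where \<alpha>\<beta>: "\<alpha> \<in> D" "\<beta> \<in> D" "\<alpha> \<noteq> \<beta>" "x = point \<alpha> 0" "y = point \<beta> 0" by auto
    obtain K where K: "\<And>n j \<alpha> \<beta>. \<lbrakk>\<alpha> \<in> subshift A; \<beta> \<in> subshift A;
        \<And>k. j \<le> k \<Longrightarrow> k \<le> j + K \<Longrightarrow> \<alpha> k = \<beta> k\<rbrakk> \<Longrightarrow>
        dist (iterates f n j (point \<alpha> n)) (iterates f n j (point \<beta> n)) < \<epsilon>"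
      by (rule same_symbols_imp_close_iterates[OF \<open>\<epsilon> > 0\<close>]) blast
    show "\<exists>K. \<exists>\<^sub>\<infinity>m. \<forall>k. L * fact m \<le> k \<longrightarrow> k + K < L * fact (Suc m) \<longrightarrow>
        dist (iterates f 0 k x) (iterates f 0 k y) < \<epsilon>"
    proof (intro exI[of _ K] frequently_mono[OF _ same[OF \<alpha>\<beta>(1-3)]] allI impI)
      fix m k assume m: "\<forall>k. L * fact m \<le> k \<longrightarrow> k < L * fact (Suc m) \<longrightarrow> \<alpha> k = \<beta> k"
        and k: "L * fact m \<le> k" "k + K < L * fact (Suc m)"
      show "dist (iterates f 0 k x) (iterates f 0 k y) < \<epsilon>"
        unfolding \<alpha>\<beta>(4,5) by (rule K) (use \<alpha>\<beta> LD(2) m k in auto)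
    qed
  next
    fix x y assume "{x} \<in> ?S" "{y} \<in> ?S" "x \<noteq> y"
    then obtain \<alpha> \<beta> where \<alpha>\<beta>: "\<alpha> \<in> D" "\<beta> \<in> D" "\<alpha> \<noteq> \<beta>" "x = point \<alpha> 0" "y = point \<beta> 0" by auto
    then have "\<alpha> \<in> subshift A" "\<beta> \<in> subshift A" using LD(2) by auto
    then show "\<exists>K. \<exists>\<^sub>\<infinity>m. \<forall>k. L * fact m \<le> k \<longrightarrow> k + K < L * fact (Suc m) \<longrightarrow>
        \<not> dist (iterates f 0 k x) (iterates f 0 k y) < \<delta>"
      unfolding \<alpha>\<beta>(4,5) using \<delta>
      by (intro exI[of _ "2 * L"] frequently_mono[OF _ different[OF \<alpha>\<beta>(1-3)]] allI impI) blast
  qed auto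
qed

text \<open>One scrambled set of singletons serves both notions: frequencies at block ends give
  distributional chaos, and single times from the same blocks give the Li-Yorke limits.\<close>

lemma chaos:
  assumes "irreducible_matrix A" "(\<Sum>j\<in>UNIV. A $ i $ j) \<ge> 2"
  shows "strongly_Li_Yorke_chaotic nonempty_compacts hausdorff_dist (induced f)"
    and "distributionally_chaotic nonempty_compacts hausdorff_dist (induced f)"
proof -
  interpret H: Metric_space nonempty_compacts "hausdorff_dist :: 'a set \<Rightarrow> _"
    by (rule Metric_space_hausdorff)
  obtain S L \<delta> where S: "S \<subseteq> (\<lambda>x. {x}) ` UNIV" "uncountable S" and "L > 0" "\<delta> > 0"
    and close: "\<And>x y \<epsilon>. \<lbrakk>{x} \<in> S; {y} \<in> S; x \<noteq> y; \<epsilon> > 0\<rbrakk> \<Longrightarrow>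
      \<exists>K. \<exists>\<^sub>\<infinity>m. \<forall>k. L * fact m \<le> k \<longrightarrow> k + K < L * fact (Suc m) \<longrightarrow>
        dist (iterates f 0 k x) (iterates f 0 k y) < \<epsilon>"
    and far: "\<And>x y. \<lbrakk>{x} \<in> S; {y} \<in> S; x \<noteq> y\<rbrakk> \<Longrightarrow>
      \<exists>K. \<exists>\<^sub>\<infinity>m. \<forall>k. L * fact m \<le> k \<longrightarrow> k + K < L * fact (Suc m) \<longrightarrow>
        \<not> dist (iterates f 0 k x) (iterates f 0 k y) < \<delta>"
    by (rule scrambled_set[OF assms]) blast
  have sub: "S \<subseteq> nonempty_compacts" using S(1) by auto
  have singleton: "\<exists>x. B = {x}" if "B \<in> S" for B using S(1) that by blast
  let ?e = "\<lambda>B C n. hausdorff_dist (iterates (induced f) 0 n B) (iterates (induced f) 0 n C)"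
  have near: "\<exists>K. \<exists>\<^sub>\<infinity>m. \<forall>k. L * fact m \<le> k \<longrightarrow> k + K < L * fact (Suc m) \<longrightarrow> ?e B C k < \<epsilon>"
    if BC: "B \<in> S" "C \<in> S" "B \<noteq> C" "\<epsilon> > 0" for B C \<epsilon>
  proof -
    obtain x y where "B = {x}" "C = {y}" using singleton[OF BC(1)] singleton[OF BC(2)] by blast
    then show ?thesis using close[of x y \<epsilon>] BC by (simp add: iterates_induced_singleton)
  qed
  have apart: "\<exists>K. \<exists>\<^sub>\<infinity>m. \<forall>k. L * fact m \<le> k \<longrightarrow> k + K < L * fact (Suc m) \<longrightarrow> \<not> ?e B C k < \<delta>"
    if BC: "B \<in> S" "C \<in> S" "B \<noteq> C" for B C
  proof -
    obtain x y where "B = {x}" "C = {y}" using singleton[OF BC(1)] singleton[OF BC(2)] by blast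
    then show ?thesis using far[of x y] BC by (simp add: iterates_induced_singleton)
  qed
  have "limsup (\<lambda>n. ereal (close_frequency hausdorff_dist (induced f) B C \<epsilon> n)) = 1"
    if "B \<in> S" "C \<in> S" "B \<noteq> C" "\<epsilon> > 0" for B C \<epsilon>
  proof -
    from near[OF that]
    obtain K where "\<exists>\<^sub>\<infinity>m. \<forall>k. L * fact m \<le> k \<longrightarrow> k + K < L * fact (Suc m) \<longrightarrow> ?e B C k < \<epsilon>" ..
    then show ?thesis
      unfolding close_frequency_eq_frequency[OF H.nonneg] by (rule limsup_frequency_eq_1[OF \<open>L > 0\<close>])
  qed
  moreover have "liminf (\<lambda>n. ereal (close_frequency hausdorff_dist (induced f) B C \<delta> n)) = 0"
    if "B \<in> S" "C \<in> S" "B \<noteq> C" for B C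
  proof -
    from apart[OF that]
    obtain K where "\<exists>\<^sub>\<infinity>m. \<forall>k. L * fact m \<le> k \<longrightarrow> k + K < L * fact (Suc m) \<longrightarrow> \<not> ?e B C k < \<delta>" ..
    then show ?thesis
      unfolding close_frequency_eq_frequency[OF H.nonneg] by (rule liminf_frequency_eq_0[OF \<open>L > 0\<close>])
  qed
  ultimately show "distributionally_chaotic nonempty_compacts hausdorff_dist (induced f)"
    unfolding distributionally_chaotic_def
    by (intro exI[of _ S] exI[of _ \<delta>] conjI ballI impI allI sub S(2) \<open>\<delta> > 0\<close>)
  have "liminf (\<lambda>n. ereal (?e B C n)) = 0" if BC: "B \<in> S" "C \<in> S" "B \<noteq> C" for B C
  proof (rule antisym)
    show "liminf (\<lambda>n. ereal (?e B C n)) \<le> 0"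
    proof (rule ccontr)
      assume "\<not> ?thesis"
      then obtain c where "0 < ereal c" and c: "ereal c < liminf (\<lambda>n. ereal (?e B C n))"
        using ereal_dense2[of 0] by (auto simp: not_le)
      then have "c > 0" by simp
      from near[OF BC this]
      obtain K where "\<exists>\<^sub>\<infinity>m. \<forall>k. L * fact m \<le> k \<longrightarrow> k + K < L * fact (Suc m) \<longrightarrow> ?e B C k < c" ..
      then have "\<exists>\<^sub>\<infinity>n. ?e B C n < c" by (rule INFM_time_block[OF \<open>L > 0\<close>])
      moreover have "\<forall>\<^sub>F n in sequentially. \<not> ?e B C n < c"
        using less_LiminfD[OF c] by eventually_elim simp
      ultimately show False by (simp add: frequently_def cofinite_eq_sequentially)
    qed
    show "0 \<le> liminf (\<lambda>n. ereal (?e B C n))"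
      by (rule Liminf_bounded) simp
  qed
  \<comment> \<open>The distance is at least \<delta> infinitely often, so the limit superior is at
    least \<delta>; halving makes the inequality strict.\<close>
  moreover have "ereal (\<delta> / 2) < limsup (\<lambda>n. ereal (?e B C n))"
    if BC: "B \<in> S" "C \<in> S" "B \<noteq> C" for B C
  proof (rule ccontr)
    assume "\<not> ?thesis"
    then have "limsup (\<lambda>n. ereal (?e B C n)) \<le> ereal (\<delta> / 2)" by simp
    also have "\<dots> < ereal \<delta>" using \<open>\<delta> > 0\<close> by simp
    finally have "\<forall>\<^sub>F n in sequentially. ereal (?e B C n) < ereal \<delta>" by (rule Limsup_lessD)
    moreover from apart[OF BC]
    obtain K where "\<exists>\<^sub>\<infinity>m. \<forall>k. L * fact m \<le> k \<longrightarrow> k + K < L * fact (Suc m) \<longrightarrow> \<not> ?e B C k < \<delta>" ..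
    then have "\<exists>\<^sub>\<infinity>n. \<not> ?e B C n < \<delta>" by (rule INFM_time_block[OF \<open>L > 0\<close>])
    ultimately show False by (simp add: frequently_def cofinite_eq_sequentially)
  qed
  moreover have "H.mbounded (range (\<lambda>n. iterates (induced f) 0 n B))" if B: "B \<in> S" for B
  proof -
    obtain x where x: "B = {x}" using singleton[OF B] ..
    obtain M where M: "\<And>y. dist x y \<le> M"
      using bounded_any[of UNIV] unfolding bounded_any_center[where a = x] by auto
    show ?thesis
      unfolding H.mbounded_def
      by (intro exI[of _ "{x}"] exI[of _ M]) (auto simp: x iterates_induced_singleton M)
  qed
  ultimately show "strongly_Li_Yorke_chaotic nonempty_compacts hausdorff_dist (induced f)"
    unfolding strongly_Li_Yorke_chaotic_def
    using \<open>\<delta> > 0\<close> by (intro exI[of _ "\<delta> / 2"] exI[of _ S] conjI ballI impI sub S(2)) simp_all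
qed

end

theorem theorem4p7:
  fixes f :: "nat \<Rightarrow> 'a::metric_space \<Rightarrow> 'a"
    and A :: "nat ^ 'n ^ 'n"
    and Vn :: "'n \<Rightarrow> nat \<Rightarrow> 'a set"
    and V :: "'n \<Rightarrow> 'a set"
  assumes "compact (UNIV :: 'a set)"
    and "\<And>n. continuous_on UNIV (f n)"
    and "equi_continuous dist (\<lambda>n. UNIV) dist f"
    and "transition_matrix A"
    and "\<And>i n. Vn i n \<noteq> {} \<and> closed (Vn i n)"
    and "\<And>i. closed (V i)"
    and "\<And>i j. i \<noteq> j \<Longrightarrow> V i \<inter> V j = {}"
    and "\<And>i n. Vn i n \<subseteq> V i"
    and "\<And>\<alpha> m n. \<alpha> \<in> subshift A \<Longrightarrow> itinerary_set f Vn \<alpha> m n \<noteq> {}"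
    and "\<And>\<alpha>. \<alpha> \<in> subshift A \<Longrightarrow>
           uniform_limit UNIV (\<lambda>m n. diameter (itinerary_set f Vn \<alpha> m n)) (\<lambda>n. 0) sequentially"
  shows "(\<exists>\<C> :: nat \<Rightarrow> 'a set set.
            (\<forall>n. \<C> n \<noteq> {} \<and> compactin hausdorff_topology (\<C> n) \<and>
                 \<C> n \<subseteq> (\<Union>i. compacts_within (Vn i n)) \<and>
                 induced f n ` \<C> n = \<C> (Suc n)) \<and>
            topologically_equi_conjugate hausdorff_dist \<C> (induced f)
              symbol_dist (subshift A) shift \<and>
            topological_entropy hausdorff_topology (induced f) (\<C> 0) = ereal (ln (matrix_rho A))) \<and>
         (irreducible_matrix A \<and> (\<exists>i\<^sub>0. (\<Sum>j\<in>UNIV. A $ i\<^sub>0 $ j) \<ge> 2) \<longrightarrow>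
            strongly_Li_Yorke_chaotic nonempty_compacts hausdorff_dist (induced f) \<and>
            distributionally_chaotic nonempty_compacts hausdorff_dist (induced f))"
proof -
  interpret itinerary_system f A Vn V
    by (rule itinerary_system.intro[OF assms(1-4) _ assms(6-10)]) (simp add: assms(5))
  show ?thesis
    by (intro conjI impI exI[of _ family] allI family_nonempty family_compactin family_subset
        induced_family family_equi_conjugate family_entropy; elim conjE exE; rule chaos)
qed

end
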